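(* Let $X$ be a uniformly locally finite metric space. Any $\Phi\in\mathrm{Aut}(\mathrm{C}^*(X))$ extends to an automorphism of $\mathrm{BD}(X)$. Moreover, $\mathrm{Inn}(\mathrm{BD}(X))$ is a normal subgroup of $\mathrm{Aut}(\mathrm{C}^*(X))$.
   Context: A metric space $(X,d)$ is uniformly locally finite (u.l.f.) if $\sup_{x\in X}|B_r(x)|<\infty$ for all $r>0$, where $B_r(x)$ is the closed ball of radius $r$ centered at $x$. $H$ is a separable infinite-dimensional Hilbert space. $\ell_2(X,H)$ is the Hilbert space of square-summable functions $X\to H$, and $\delta_x\otimes\eta$ is the function with value $\eta$ at $x$ and $0$ elsewhere. For $a\in\mathcal B(\ell_2(X,H))$ and $x,y\in X$, $a_{xy}\in\mathcal B(H)$ is determined by $\langle a_{xy}\xi,\eta\rangle=\langle a(\delta_x\otimes\xi),\delta_y\otimes\eta\rangle$, and $\mathrm{prop}(a)=\sup\{d(x,y)\mid a_{xy}\neq 0\}$. $\mathrm{BD}(X)$ is the norm closure of $\{a\in\mathcal B(\ell_2(X,H))\mid\mathrm{prop}(a)<\infty\}$, and the Roe algebra is $\mathrm{C}^*(X)=\{a\in \mathrm{BD}(X)\mid a_{xy}\text{ is compact for all }x,y\in X\}$, an ideal of $\mathrm{BD}(X)$. $\mathrm{Inn}(\mathrm{BD}(X))$ is the group of the maps $\mathrm{Ad}(u)\colon a\mapsto uau^*$ with $u\in\mathrm{BD}(X)$ unitary, regarded (by restriction to the ideal $\mathrm{C}^*(X)$) as automorphisms of $\mathrm{C}^*(X)$.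 *)

theory Defs
  imports "HOL-Analysis.Analysis" "HOL-Algebra.Coset"
begin

section \<open>Complex Hilbert spaces\<close>

class complex_vector = real_vector +
  fixes scaleC :: "complex \<Rightarrow> 'a \<Rightarrow> 'a" (infixr "*\<^sub>C" 75)
  assumes scaleC_add_right: "c *\<^sub>C (x + y) = c *\<^sub>C x + c *\<^sub>C y"
    and scaleC_add_left: "(c + d) *\<^sub>C x = c *\<^sub>C x + d *\<^sub>C x"
    and scaleC_scaleC: "c *\<^sub>C d *\<^sub>C x = (c * d) *\<^sub>C x"
    and scaleC_one: "1 *\<^sub>C x = x"
    and scaleR_scaleC: "r *\<^sub>R x = complex_of_real r *\<^sub>C x"

text \<open>The norm and the topology are those of the underlying real Hilbert space, whose inner product
  is the real part of the complex one.  The complex inner product is linear in the first argument.\<close>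

class complex_hilbert_space = complex_vector + real_inner + complete_space +
  fixes cinner :: "'a \<Rightarrow> 'a \<Rightarrow> complex"
  assumes cinner_commute: "cinner x y = cnj (cinner y x)"
    and cinner_add_left: "cinner (x + y) z = cinner x z + cinner y z"
    and cinner_scaleC_left: "cinner (c *\<^sub>C x) y = c * cinner x y"
    and inner_eq_Re_cinner: "inner x y = Re (cinner x y)"

lemma cinner_add_right: "cinner x (y + z) = cinner x y + cinner x (z :: 'a::complex_hilbert_space)"
  by (metis cinner_commute cinner_add_left complex_cnj_add)

lemma cinner_scaleC_right: "cinner x (c *\<^sub>C y) = cnj c * cinner x (y :: 'a::complex_hilbert_space)"
  by (metis cinner_commute cinner_scaleC_left complex_cnj_mult)

lemma cinner_self: "cinner x x = complex_of_real ((norm (x :: 'a::complex_hilbert_space))\<^sup>2)"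
proof (rule complex_eqI)
  show "Re (cinner x x) = Re (complex_of_real ((norm x)\<^sup>2))"
    by (simp add: power2_norm_eq_inner inner_eq_Re_cinner)
  have "Im (cinner x x) = - Im (cinner x x)"
    by (subst cinner_commute) simp
  then show "Im (cinner x x) = Im (complex_of_real ((norm x)\<^sup>2))"
    by simp
qed

lemma norm_scaleC: "norm (c *\<^sub>C x) = cmod c * norm (x :: 'a::complex_hilbert_space)"
proof -
  have "complex_of_real ((norm (c *\<^sub>C x))\<^sup>2) = c * cnj c * complex_of_real ((norm x)\<^sup>2)"
    by (simp add: cinner_self[symmetric] cinner_scaleC_left cinner_scaleC_right mult_ac del: of_real_power)
  also have "\<dots> = complex_of_real ((cmod c * norm x)\<^sup>2)"
    by (simp only: complex_norm_square[symmetric] power_mult_distrib of_real_mult)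
  finally have "(norm (c *\<^sub>C x))\<^sup>2 = (cmod c * norm x)\<^sup>2"
    using of_real_eq_iff by blast
  then show ?thesis by simp
qed

lemma norm_cinner_le: "cmod (cinner x y) \<le> norm x * norm (y :: 'a::complex_hilbert_space)"
proof (cases "cinner x y = 0")
  case False
  define c where "c = cnj (sgn (cinner x y))"
  have c: "cmod c = 1" using False by (simp add: c_def norm_sgn)
  have "c * cinner x y = complex_of_real (cmod (cinner x y))"
    using False by (simp add: c_def sgn_div_norm scaleR_conv_of_real field_simps)
      (metis complex_norm_square of_real_power power2_eq_square)
  then have "cmod (cinner x y) = inner (c *\<^sub>C x) y"
    by (simp add: inner_eq_Re_cinner cinner_scaleC_left)
  also have "\<dots> \<le> norm (c *\<^sub>C x) * norm y" by (rule norm_cauchy_schwarz)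
  finally show ?thesis by (simp add: norm_scaleC c)
qed simp

lemma bounded_linear_scaleC: "bounded_linear (\<lambda>x::'a::complex_hilbert_space. c *\<^sub>C x)"
  by (rule bounded_linear_intro[where K = "cmod c"])
    (auto simp: scaleC_add_right scaleR_scaleC scaleC_scaleC norm_scaleC mult.commute)

section \<open>The Hilbert space $\ell_2(X, H)$\<close>

typedef (overloaded) ('x, 'h::complex_hilbert_space) ell2 =
  "{f :: 'x \<Rightarrow> 'h. (\<lambda>x. (norm (f x))\<^sup>2) summable_on UNIV}"
  by (rule exI[of _ "\<lambda>_. 0"]) simp

setup_lifting type_definition_ell2

lemma l2_summable_inner:
  fixes f g :: "'x \<Rightarrow> 'h::complex_hilbert_space"
  assumes "(\<lambda>x. (norm (f x))\<^sup>2) summable_on UNIV" "(\<lambda>x. (norm (g x))\<^sup>2) summable_on UNIV"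
  shows "(\<lambda>x. cinner (f x) (g x)) summable_on UNIV"
proof (rule abs_summable_summable[OF summable_on_comparison_test])
  show "(\<lambda>x. (norm (f x))\<^sup>2 + (norm (g x))\<^sup>2) summable_on UNIV"
    by (intro summable_on_add assms)
  fix x
  have "norm (f x) * norm (g x) \<le> (norm (f x))\<^sup>2 + (norm (g x))\<^sup>2"
    using sum_squares_bound[of "norm (f x)" "norm (g x)"]
      mult_nonneg_nonneg[OF norm_ge_zero[of "f x"] norm_ge_zero[of "g x"]] by linarith
  then show "norm (cinner (f x) (g x)) \<le> (norm (f x))\<^sup>2 + (norm (g x))\<^sup>2"
    using norm_cinner_le[of "f x" "g x"] by linarith
qed simp_all

lemma l2_add:
  fixes f g :: "'x \<Rightarrow> 'h::complex_hilbert_space"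
  assumes "(\<lambda>x. (norm (f x))\<^sup>2) summable_on UNIV" "(\<lambda>x. (norm (g x))\<^sup>2) summable_on UNIV"
  shows "(\<lambda>x. (norm (f x + g x))\<^sup>2) summable_on UNIV"
proof (rule summable_on_comparison_test)
  show "(\<lambda>x. 2 * (norm (f x))\<^sup>2 + 2 * (norm (g x))\<^sup>2) summable_on UNIV"
    by (intro summable_on_add summable_on_cmult_right assms)
  fix x
  have "(norm (f x + g x))\<^sup>2 \<le> (norm (f x) + norm (g x))\<^sup>2"
    by (intro power_mono norm_triangle_ineq norm_ge_zero)
  also have "\<dots> \<le> 2 * (norm (f x))\<^sup>2 + 2 * (norm (g x))\<^sup>2"
    using sum_squares_bound[of "norm (f x)" "norm (g x)"] by (simp add: power2_sum)
  finally show "(norm (f x + g x))\<^sup>2 \<le> 2 * (norm (f x))\<^sup>2 + 2 * (norm (g x))\<^sup>2" .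
qed simp_all

lemma l2_scaleC:
  fixes f :: "'x \<Rightarrow> 'h::complex_hilbert_space"
  assumes "(\<lambda>x. (norm (f x))\<^sup>2) summable_on UNIV"
  shows "(\<lambda>x. (norm (c *\<^sub>C f x))\<^sup>2) summable_on UNIV"
  by (simp add: norm_scaleC power_mult_distrib summable_on_cmult_right assms)

lemma scaleC_minus_one: "(- 1) *\<^sub>C (x :: 'a::complex_vector) = - x"
  using scaleR_scaleC[of "-1" x] by simp

instantiation ell2 :: (type, complex_hilbert_space) complex_vector
begin

lift_definition zero_ell2 :: "('a, 'b) ell2" is "\<lambda>_. 0" by simp

lift_definition plus_ell2 :: "('a, 'b) ell2 \<Rightarrow> ('a, 'b) ell2 \<Rightarrow> ('a, 'b) ell2"
  is "\<lambda>f g x. f x + g x" by (rule l2_add)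

lift_definition uminus_ell2 :: "('a, 'b) ell2 \<Rightarrow> ('a, 'b) ell2"
  is "\<lambda>f x. - f x" by simp

lift_definition minus_ell2 :: "('a, 'b) ell2 \<Rightarrow> ('a, 'b) ell2 \<Rightarrow> ('a, 'b) ell2"
  is "\<lambda>f g x. f x - g x"
proof -
  fix f g :: "'a \<Rightarrow> 'b"
  assume "(\<lambda>x. (norm (f x))\<^sup>2) summable_on UNIV" "(\<lambda>x. (norm (g x))\<^sup>2) summable_on UNIV"
  then show "(\<lambda>x. (norm (f x - g x))\<^sup>2) summable_on UNIV"
    using l2_add[of f "\<lambda>x. - g x"] by simp
qed

lift_definition scaleR_ell2 :: "real \<Rightarrow> ('a, 'b) ell2 \<Rightarrow> ('a, 'b) ell2"
  is "\<lambda>r f x. r *\<^sub>R f x"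
  by (simp add: power_mult_distrib summable_on_cmult_right)

lift_definition scaleC_ell2 :: "complex \<Rightarrow> ('a, 'b) ell2 \<Rightarrow> ('a, 'b) ell2"
  is "\<lambda>c f x. c *\<^sub>C f x" by (rule l2_scaleC)

instance
  by standard
    (transfer; simp add: fun_eq_iff algebra_simps scaleC_add_right scaleC_add_left scaleC_scaleC
      scaleC_one scaleR_scaleC)+

end

instantiation ell2 :: (type, complex_hilbert_space) real_inner
begin

lift_definition inner_ell2 :: "('a, 'b) ell2 \<Rightarrow> ('a, 'b) ell2 \<Rightarrow> real"
  is "\<lambda>f g. \<Sum>\<^sub>\<infinity>x. inner (f x) (g x)" .

definition norm_ell2 :: "('a, 'b) ell2 \<Rightarrow> real"
  where "norm_ell2 f = sqrt (inner f f)"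

definition dist_ell2 :: "('a, 'b) ell2 \<Rightarrow> ('a, 'b) ell2 \<Rightarrow> real"
  where "dist_ell2 f g = norm (f - g)"

definition sgn_ell2 :: "('a, 'b) ell2 \<Rightarrow> ('a, 'b) ell2"
  where "sgn_ell2 f = inverse (norm f) *\<^sub>R f"

definition [code del]:
  "(uniformity :: (('a, 'b) ell2 \<times> ('a, 'b) ell2) filter) = (INF e\<in>{0 <..}. principal {(x, y). dist x y < e})"

definition open_ell2 :: "('a, 'b) ell2 set \<Rightarrow> bool"
  where [code del]: "open_ell2 S = (\<forall>x\<in>S. \<forall>\<^sub>F (x', y) in uniformity. x' = x \<longrightarrow> y \<in> S)"

lemma l2_summable_real_inner:
  fixes f g :: "'x \<Rightarrow> 'h::complex_hilbert_space"
  assumes "(\<lambda>x. (norm (f x))\<^sup>2) summable_on UNIV" "(\<lambda>x. (norm (g x))\<^sup>2) summable_on UNIV"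
  shows "(\<lambda>x. inner (f x) (g x)) summable_on UNIV"
  unfolding inner_eq_Re_cinner by (intro summable_on_Re l2_summable_inner assms)

instance
proof
  fix f g h :: "('a, 'b) ell2" and r :: real
  show "inner f g = inner g f"
    by transfer (simp add: inner_commute)
  show "inner (f + g) h = inner f h + inner g h"
    by transfer (simp add: inner_add_left infsum_add l2_summable_real_inner)
  show "inner (r *\<^sub>R f) g = r * inner f g"
    by transfer (simp add: infsum_cmult_right l2_summable_real_inner)
  show "0 \<le> inner f f"
    by transfer (simp add: infsum_nonneg)
  show "inner f f = 0 \<longleftrightarrow> f = 0"
  proof
    assume "inner f f = 0"
    then show "f = 0"
    proof transfer
      fix f :: "'a \<Rightarrow> 'b"
      assume s: "(\<lambda>x. (norm (f x))\<^sup>2) summable_on UNIV" and z: "(\<Sum>\<^sub>\<infinity>x. inner (f x) (f x)) = 0"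
      have "inner (f x) (f x) = 0" for x
        using nonneg_infsum_le_0D[of "\<lambda>x. inner (f x) (f x)" UNIV x] s z
        by (simp add: l2_summable_real_inner)
      then show "f = (\<lambda>_. 0)" by (simp add: fun_eq_iff)
    qed
  next
    assume "f = 0" then show "inner f f = 0" by transfer simp
  qed
qed (simp_all add: norm_ell2_def dist_ell2_def sgn_ell2_def uniformity_ell2_def open_ell2_def)

end

lemma norm_ell2_power2: "(norm f)\<^sup>2 = (\<Sum>\<^sub>\<infinity>x. (norm (Rep_ell2 f x))\<^sup>2)"
  by (simp add: power2_norm_eq_inner inner_ell2.rep_eq)

lemma sum_norm_ell2_le: "finite S \<Longrightarrow> (\<Sum>x\<in>S. (norm (Rep_ell2 f x))\<^sup>2) \<le> (norm f)\<^sup>2"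
  unfolding norm_ell2_power2 using Rep_ell2[of f] by (intro finite_sum_le_infsum) auto

lemma norm_Rep_ell2_le: "norm (Rep_ell2 f x) \<le> norm f"
  using sum_norm_ell2_le[of "{x}" f] by simp

instance ell2 :: (type, complex_hilbert_space) complete_space
proof
  fix F :: "nat \<Rightarrow> ('a, 'b) ell2"
  assume F: "Cauchy F"
  have "Cauchy (\<lambda>n. Rep_ell2 (F n) x)" for x
  proof (rule metric_CauchyI)
    fix e :: real assume "0 < e"
    then obtain M where M: "\<And>m n. m \<ge> M \<Longrightarrow> n \<ge> M \<Longrightarrow> dist (F m) (F n) < e"
      using metric_CauchyD[OF F] by blast
    have "dist (Rep_ell2 (F m) x) (Rep_ell2 (F n) x) \<le> dist (F m) (F n)" for m n
      using norm_Rep_ell2_le[of "F m - F n" x] by (simp add: dist_norm minus_ell2.rep_eq)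
    then show "\<exists>M. \<forall>m\<ge>M. \<forall>n\<ge>M. dist (Rep_ell2 (F m) x) (Rep_ell2 (F n) x) < e"
      using M by (meson le_less_trans)
  qed
  then have "\<forall>x. \<exists>l. (\<lambda>n. Rep_ell2 (F n) x) \<longlonglongrightarrow> l"
    using Cauchy_convergent convergent_def by blast
  then obtain g where g: "\<And>x. (\<lambda>n. Rep_ell2 (F n) x) \<longlonglongrightarrow> g x"
    by metis
  have tail: "\<exists>M. \<forall>n\<ge>M. \<forall>S. finite S \<longrightarrow> (\<Sum>x\<in>S. (norm (Rep_ell2 (F n) x - g x))\<^sup>2) \<le> e\<^sup>2"
    if "0 < e" for e :: real
  proof -
    obtain M where M: "\<And>m n. m \<ge> M \<Longrightarrow> n \<ge> M \<Longrightarrow> dist (F m) (F n) < e"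
      using metric_CauchyD[OF F \<open>0 < e\<close>] by blast
    have "(\<Sum>x\<in>S. (norm (Rep_ell2 (F n) x - g x))\<^sup>2) \<le> e\<^sup>2" if "n \<ge> M" "finite S" for n S
    proof (rule LIMSEQ_le_const2)
      show "(\<lambda>m. \<Sum>x\<in>S. (norm (Rep_ell2 (F n) x - Rep_ell2 (F m) x))\<^sup>2)
              \<longlonglongrightarrow> (\<Sum>x\<in>S. (norm (Rep_ell2 (F n) x - g x))\<^sup>2)"
        by (intro tendsto_intros g)
      have "(\<Sum>x\<in>S. (norm (Rep_ell2 (F n) x - Rep_ell2 (F m) x))\<^sup>2) \<le> e\<^sup>2" if "m \<ge> M" for m
      proof -
        have "(\<Sum>x\<in>S. (norm (Rep_ell2 (F n - F m) x))\<^sup>2) \<le> (norm (F n - F m))\<^sup>2"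
          by (rule sum_norm_ell2_le[OF \<open>finite S\<close>])
        also have "\<dots> \<le> e\<^sup>2"
          using M[OF \<open>n \<ge> M\<close> \<open>m \<ge> M\<close>] by (intro power_mono) (simp_all add: dist_norm)
        finally show ?thesis by (simp add: minus_ell2.rep_eq)
      qed
      then show "\<exists>N. \<forall>m\<ge>N. (\<Sum>x\<in>S. (norm (Rep_ell2 (F n) x - Rep_ell2 (F m) x))\<^sup>2) \<le> e\<^sup>2"
        by blast
    qed
    then show ?thesis by blast
  qed
  obtain M where M: "\<And>S. finite S \<Longrightarrow> (\<Sum>x\<in>S. (norm (Rep_ell2 (F M) x - g x))\<^sup>2) \<le> 1"
    using tail[of 1] by auto
  have d: "(\<lambda>x. (norm (Rep_ell2 (F M) x - g x))\<^sup>2) summable_on UNIV"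
    by (rule nonneg_bdd_above_summable_on) (auto intro!: bdd_aboveI[of _ 1] M)
  have "(\<lambda>x. (norm (g x))\<^sup>2) summable_on UNIV"
    using l2_add[of "Rep_ell2 (F M)" "\<lambda>x. - (Rep_ell2 (F M) x - g x)"] Rep_ell2[of "F M"] d
    by (simp add: norm_minus_commute)
  then obtain G where G: "g = Rep_ell2 G"
    using Rep_ell2_cases by blast
  have "F \<longlonglongrightarrow> G"
  proof (rule metric_LIMSEQ_I)
    fix e :: real assume "0 < e"
    then obtain N where
      N: "\<And>n S. n \<ge> N \<Longrightarrow> finite S \<Longrightarrow> (\<Sum>x\<in>S. (norm (Rep_ell2 (F n) x - g x))\<^sup>2) \<le> (e/2)\<^sup>2"
      using tail[of "e/2"] by auto
    have "dist (F n) G < e" if "n \<ge> N" for n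
    proof -
      have "(norm (F n - G))\<^sup>2 \<le> (e/2)\<^sup>2"
        unfolding norm_ell2_power2
      proof (rule infsum_le_finite_sums)
        show "(\<lambda>x. (norm (Rep_ell2 (F n - G) x))\<^sup>2) summable_on UNIV"
          using Rep_ell2[of "F n - G"] by simp
      qed (use N[OF that] in \<open>auto simp: minus_ell2.rep_eq G\<close>)
      then have "norm (F n - G) \<le> e/2"
        using \<open>0 < e\<close> by (simp add: power2_le_iff_abs_le)
      then show ?thesis using \<open>0 < e\<close> by (simp add: dist_norm)
    qed
    then show "\<exists>N. \<forall>n\<ge>N. dist (F n) G < e" by blast
  qed
  then show "convergent F" by (auto simp: convergent_def)
qed

instantiation ell2 :: (type, complex_hilbert_space) complex_hilbert_space
begin

lift_definition cinner_ell2 :: "('a, 'b) ell2 \<Rightarrow> ('a, 'b) ell2 \<Rightarrow> complex"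
  is "\<lambda>f g. \<Sum>\<^sub>\<infinity>x. cinner (f x) (g x)" .

instance
proof
  fix f g h :: "('a, 'b) ell2" and c :: complex
  show "cinner f g = cnj (cinner g f)"
    by transfer (simp add: infsum_cnj[symmetric] cinner_commute[symmetric])
  show "cinner (f + g) h = cinner f h + cinner g h"
    by transfer (simp add: cinner_add_left infsum_add l2_summable_inner)
  show "cinner (c *\<^sub>C f) g = c * cinner f g"
    by transfer (simp add: cinner_scaleC_left infsum_cmult_right l2_summable_inner)
  show "inner f g = Re (cinner f g)"
    by transfer (simp add: inner_eq_Re_cinner infsum_Re l2_summable_inner)
qed

end

text \<open>The vector $\delta_x \otimes \eta$.\<close>

lift_definition delta_tensor :: "'x \<Rightarrow> 'h::complex_hilbert_space \<Rightarrow> ('x, 'h) ell2"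
  is "\<lambda>x \<eta> y. if y = x then \<eta> else 0"
proof -
  fix x :: 'x and \<eta> :: 'h
  show "(\<lambda>y. (norm (if y = x then \<eta> else 0))\<^sup>2) summable_on UNIV"
    by (rule finite_nonzero_values_imp_summable_on) (auto intro: finite_subset[of _ "{x}"])
qed

section \<open>Bounded operators\<close>

text \<open>The type \<open>'a \<Rightarrow>\<^sub>L 'b\<close> of the library consists of the bounded \<^emph>\<open>real\<close>-linear operators, with the
  operator norm; the complex-linear ones form a norm-closed complex subspace.\<close>

instantiation blinfun :: (real_normed_vector, complex_hilbert_space) complex_vector
begin

lift_definition scaleC_blinfun :: "complex \<Rightarrow> ('a \<Rightarrow>\<^sub>L 'b) \<Rightarrow> ('a \<Rightarrow>\<^sub>L 'b)"
  is "\<lambda>c a v. c *\<^sub>C a v"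
  by (rule bounded_linear_compose[OF bounded_linear_scaleC])

instance
  by standard
    (transfer; simp add: fun_eq_iff scaleC_add_right scaleC_add_left scaleC_scaleC
      scaleC_one scaleR_scaleC)+

end

definition clinear_operators ::
  "('a::complex_hilbert_space \<Rightarrow>\<^sub>L 'b::complex_hilbert_space) set"
  where "clinear_operators = {a. \<forall>c v. blinfun_apply a (c *\<^sub>C v) = c *\<^sub>C blinfun_apply a v}"

definition adj ::
  "('a::complex_hilbert_space \<Rightarrow>\<^sub>L 'b::complex_hilbert_space) \<Rightarrow> ('b \<Rightarrow>\<^sub>L 'a)"
  where "adj a = (THE b. \<forall>v w. cinner (blinfun_apply a v) w = cinner v (blinfun_apply b w))"

definition compact_operator :: "('a::real_normed_vector \<Rightarrow>\<^sub>L 'b::real_normed_vector) \<Rightarrow> bool"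
  where "compact_operator a \<longleftrightarrow> compact (closure (blinfun_apply a ` cball 0 1))"

section \<open>Roe algebras\<close>

definition uniformly_locally_finite :: "'x::metric_space set \<Rightarrow> bool"
  where "uniformly_locally_finite X \<longleftrightarrow>
    (\<forall>r>0. \<exists>N::nat. \<forall>x\<in>X. finite (X \<inter> cball x r) \<and> card (X \<inter> cball x r) \<le> N)"

definition entry ::
  "(('x, 'h) ell2 \<Rightarrow>\<^sub>L ('x, 'h) ell2) \<Rightarrow> 'x \<Rightarrow> 'x \<Rightarrow> ('h::complex_hilbert_space \<Rightarrow>\<^sub>L 'h)"
  where "entry a x y = (THE b. \<forall>\<xi> \<eta>. cinner (blinfun_apply b \<xi>) \<eta> =
    cinner (blinfun_apply a (delta_tensor x \<xi>)) (delta_tensor y \<eta>))"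

text \<open>Taken in \<open>ennreal\<close>, so that the supremum of the empty set is 0.\<close>

definition propagation ::
  "(('x::metric_space, 'h::complex_hilbert_space) ell2 \<Rightarrow>\<^sub>L ('x, 'h) ell2) \<Rightarrow> ennreal"
  where "propagation a = Sup {ennreal (dist x y) | x y. entry a x y \<noteq> 0}"

definition BD :: "(('x::metric_space, 'h::complex_hilbert_space) ell2 \<Rightarrow>\<^sub>L ('x, 'h) ell2) set"
  where "BD = closure {a \<in> clinear_operators. propagation a < \<infinity>}"

definition Roe :: "(('x::metric_space, 'h::complex_hilbert_space) ell2 \<Rightarrow>\<^sub>L ('x, 'h) ell2) set"
  where "Roe = {a \<in> BD. \<forall>x y. compact_operator (entry a x y)}"

section \<open>Automorphism groups\<close>

text \<open>Automorphisms are $*$-automorphisms, represented as in \<^const>\<open>extensional\<close> function spaces by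
  functions that are undefined off the algebra, so that equality of automorphisms is equality
  of functions.\<close>

definition star_automorphisms ::
  "('a::complex_hilbert_space \<Rightarrow>\<^sub>L 'a) set \<Rightarrow> (('a \<Rightarrow>\<^sub>L 'a) \<Rightarrow> ('a \<Rightarrow>\<^sub>L 'a)) set"
  where "star_automorphisms A = {\<Phi> \<in> extensional A. bij_betw \<Phi> A A \<and>
    (\<forall>a\<in>A. \<forall>b\<in>A. \<Phi> (a + b) = \<Phi> a + \<Phi> b) \<and>
    (\<forall>c. \<forall>a\<in>A. \<Phi> (c *\<^sub>C a) = c *\<^sub>C \<Phi> a) \<and>
    (\<forall>a\<in>A. \<forall>b\<in>A. \<Phi> (a o\<^sub>L b) = \<Phi> a o\<^sub>L \<Phi> b) \<and>
    (\<forall>a\<in>A. \<Phi> (adj a) = adj (\<Phi> a))}"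

definition Aut ::
  "('a::complex_hilbert_space \<Rightarrow>\<^sub>L 'a) set \<Rightarrow> (('a \<Rightarrow>\<^sub>L 'a) \<Rightarrow> ('a \<Rightarrow>\<^sub>L 'a)) monoid"
  where "Aut A = \<lparr>carrier = star_automorphisms A,
    mult = (\<lambda>\<Phi> \<Psi>. compose A \<Phi> \<Psi>), one = (\<lambda>a\<in>A. a)\<rparr>"

definition unitary :: "('a::complex_hilbert_space \<Rightarrow>\<^sub>L 'a) \<Rightarrow> bool"
  where "unitary u \<longleftrightarrow> adj u o\<^sub>L u = id_blinfun \<and> u o\<^sub>L adj u = id_blinfun"

definition Inn ::
  "('a::complex_hilbert_space \<Rightarrow>\<^sub>L 'a) set \<Rightarrow> (('a \<Rightarrow>\<^sub>L 'a) \<Rightarrow> ('a \<Rightarrow>\<^sub>L 'a)) set"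
  where "Inn A = {\<lambda>a\<in>A. u o\<^sub>L a o\<^sub>L adj u | u. u \<in> A \<and> unitary u}"

section \<open>The definite descriptions are well defined\<close>

lemma cinner_delta_tensor_right:
  fixes f :: "('x, 'h::complex_hilbert_space) ell2"
  shows "cinner f (delta_tensor y \<eta>) = cinner (Rep_ell2 f y) \<eta>"
proof -
  have z: "cinner v 0 = 0" for v :: 'h
    using cinner_add_right[of v 0 0] by simp
  have "cinner f (delta_tensor y \<eta>) = (\<Sum>\<^sub>\<infinity>x. cinner (Rep_ell2 f x) (if x = y then \<eta> else 0))"
    by (simp add: cinner_ell2.rep_eq delta_tensor.rep_eq)
  also have "\<dots> = (\<Sum>\<^sub>\<infinity>x\<in>{y}. cinner (Rep_ell2 f x) (if x = y then \<eta> else 0))"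
    by (rule infsum_cong_neutral) (auto simp: z)
  finally show ?thesis by simp
qed

lemma cinner_ext:
  assumes "\<And>w. cinner u w = cinner v w"
  shows "u = (v :: 'a::complex_hilbert_space)"
proof -
  have "inner u (u - v) = inner v (u - v)"
    using assms[of "u - v"] by (simp add: inner_eq_Re_cinner)
  then have "inner (u - v) (u - v) = 0"
    by (simp add: inner_diff_left)
  then show ?thesis by simp
qed

lemma norm_delta_tensor: "norm (delta_tensor x \<xi>) = norm \<xi>"
proof -
  have "complex_of_real ((norm (delta_tensor x \<xi>))\<^sup>2) = complex_of_real ((norm \<xi>)\<^sup>2)"
    by (simp only: cinner_self[symmetric] cinner_delta_tensor_right)
      (simp add: delta_tensor.rep_eq)
  then show ?thesis
    by (metis norm_ge_zero of_real_eq_iff power2_eq_imp_eq)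
qed

lemma entry_apply:
  fixes a :: "('x, 'h::complex_hilbert_space) ell2 \<Rightarrow>\<^sub>L ('x, 'h) ell2"
  shows "blinfun_apply (entry a x y) \<xi> = Rep_ell2 (blinfun_apply a (delta_tensor x \<xi>)) y"
proof -
  let ?b = "\<lambda>\<xi>. Rep_ell2 (blinfun_apply a (delta_tensor x \<xi>)) y"
  have add: "delta_tensor x (\<xi> + \<eta>) = delta_tensor x \<xi> + delta_tensor x \<eta>" for \<xi> \<eta> :: 'h
    by transfer auto
  have scale: "delta_tensor x (r *\<^sub>R \<xi>) = r *\<^sub>R delta_tensor x \<xi>" for r and \<xi> :: 'h
    by transfer auto
  have bl: "bounded_linear ?b"
  proof (rule bounded_linear_intro[where K = "norm a"])
    fix \<xi> :: 'h
    show "norm (?b \<xi>) \<le> norm \<xi> * norm a"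
      using norm_Rep_ell2_le[of "blinfun_apply a (delta_tensor x \<xi>)" y]
        norm_blinfun[of a "delta_tensor x \<xi>"]
      by (simp add: norm_delta_tensor mult.commute)
  qed (simp_all add: add scale blinfun.add_right blinfun.scaleR_right plus_ell2.rep_eq scaleR_ell2.rep_eq)
  have "entry a x y = Blinfun ?b"
    unfolding entry_def cinner_delta_tensor_right
  proof (rule the_equality)
    show "\<forall>\<xi> \<eta>. cinner (blinfun_apply (Blinfun ?b) \<xi>) \<eta> = cinner (?b \<xi>) \<eta>"
      by (simp add: bounded_linear_Blinfun_apply[OF bl])
    fix b assume "\<forall>\<xi> \<eta>. cinner (blinfun_apply b \<xi>) \<eta> = cinner (?b \<xi>) \<eta>"
    then show "b = Blinfun ?b"
      by (intro blinfun_eqI) (auto simp: bounded_linear_Blinfun_apply[OF bl] intro: cinner_ext)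
  qed
  then show ?thesis by (simp add: bounded_linear_Blinfun_apply[OF bl])
qed

lemma riesz_representation:
  fixes \<phi> :: "'a::{real_inner, complete_space} \<Rightarrow> real"
  assumes "bounded_linear \<phi>"
  shows "\<exists>z. \<forall>x. \<phi> x = inner x z"
proof -
  interpret bounded_linear \<phi> by fact
  obtain K where K: "\<And>x. norm (\<phi> x) \<le> norm x * K" using bounded by blast
  define J where "J x = inner x x - 2 * \<phi> x" for x
  have lower: "- K\<^sup>2 \<le> J x" for x
  proof -
    have "0 \<le> (norm x - K)\<^sup>2" by simp
    then show ?thesis
      using K[of x] by (simp add: J_def power2_norm_eq_inner[symmetric] power2_diff)
  qed
  define m where "m = Inf (range J)"
  have bdd: "bdd_below (range J)" by (rule bdd_belowI[of _ "- K\<^sup>2"]) (auto simp: lower)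
  have m: "m \<le> J x" for x
    unfolding m_def by (rule cInf_lower[OF _ bdd]) simp
  have "\<exists>x. J x < m + 1 / Suc n" for n
    using cInf_lessD[of "range J" "m + 1 / Suc n"] by (auto simp: m_def)
  then obtain s where s: "\<And>n. J (s n) < m + 1 / Suc n" by metis
  have par: "(norm (x - y))\<^sup>2 \<le> 2 * (J x - m) + 2 * (J y - m)" for x y
  proof -
    have "(norm (x - y))\<^sup>2 = 2 * J x + 2 * J y - 4 * J ((1/2) *\<^sub>R (x + y))"
      unfolding J_def power2_norm_eq_inner
      by (simp add: scaleR add inner_simps inner_commute[of y x] field_simps)
    moreover have "4 * m \<le> 4 * J ((1/2) *\<^sub>R (x + y))" using m by simp
    ultimately show ?thesis by (simp add: algebra_simps)
  qed
  have "Cauchy s"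
  proof (rule metric_CauchyI)
    fix e :: real assume e: "0 < e"
    then obtain M :: nat where M: "4 / e\<^sup>2 < real M"
      using reals_Archimedean2 by blast
    have "dist (s i) (s j) < e" if "i \<ge> M" "j \<ge> M" for i j
    proof -
      have f: "1 / Suc k < e\<^sup>2 / 4" if "k \<ge> M" for k
      proof -
        have "4 / e\<^sup>2 < real (Suc k)" using M that by linarith
        then show ?thesis using e by (simp add: field_simps)
      qed
      have "(norm (s i - s j))\<^sup>2 < e\<^sup>2"
      proof -
        have arith: "p \<le> 2 * (a - m) + 2 * (b - m) \<Longrightarrow> a < m + u \<Longrightarrow> u < q / 4 \<Longrightarrow>
            b < m + v \<Longrightarrow> v < q / 4 \<Longrightarrow> p < q" for p q a b u v :: real
          by (simp add: field_simps)
        show ?thesis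
          by (rule arith[OF par s[of i] f[OF \<open>i \<ge> M\<close>] s[of j] f[OF \<open>j \<ge> M\<close>]])
      qed
      then show ?thesis using e by (simp add: dist_norm power2_less_imp_less)
    qed
    then show "\<exists>M. \<forall>i\<ge>M. \<forall>j\<ge>M. dist (s i) (s j) < e" by blast
  qed
  then obtain z where z: "s \<longlonglongrightarrow> z" using Cauchy_convergent convergent_def by blast
  have "(\<lambda>n. J (s n)) \<longlonglongrightarrow> J z"
    unfolding J_def by (intro tendsto_intros z tendsto)
  moreover have "(\<lambda>n. m + 1 / real (Suc n)) \<longlonglongrightarrow> m + 0"
    by (intro tendsto_add tendsto_const LIMSEQ_Suc[OF lim_1_over_n])
  ultimately have "J z \<le> m + 0"
    by (rule LIMSEQ_le) (use s in \<open>auto intro: less_imp_le\<close>)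
  then have min: "J z \<le> J x" for x using m[of x] by simp
  have "\<phi> x = inner x z" for x
  proof (rule ccontr)
    define d where "d = inner x z - \<phi> x"
    assume "\<phi> x \<noteq> inner x z"
    then have d: "d \<noteq> 0" by (simp add: d_def)
    define q where "q = inner x x + 1"
    have q: "q > 0" by (simp add: q_def add_nonneg_pos)
    define t where "t = - d / q"
    have "J (z + t *\<^sub>R x) = J z + 2 * t * d + t\<^sup>2 * inner x x"
      unfolding J_def d_def
      by (simp add: scaleR add inner_simps inner_commute[of z x] algebra_simps power2_eq_square)
    with min[of "z + t *\<^sub>R x"] have "0 \<le> 2 * t * d + t\<^sup>2 * inner x x" by linarith
    also have "\<dots> \<le> 2 * t * d + t\<^sup>2 * q" by (simp add: q_def algebra_simps)
    also have "\<dots> = - d\<^sup>2 / q" using q by (simp add: t_def field_simps power2_eq_square)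
    finally show False using d q by (simp add: field_simps)
  qed
  then show ?thesis by blast
qed

lemma adj_cinner:
  fixes a :: "'a::complex_hilbert_space \<Rightarrow>\<^sub>L 'b::complex_hilbert_space"
  assumes "a \<in> clinear_operators"
  shows "cinner (blinfun_apply a v) w = cinner v (blinfun_apply (adj a) w)"
proof -
  have lin: "blinfun_apply a (c *\<^sub>C v) = c *\<^sub>C blinfun_apply a v" for c v
    using assms by (simp add: clinear_operators_def)
  have "\<exists>z. \<forall>v. inner (blinfun_apply a v) w = inner v z" for w
    by (rule riesz_representation)
      (intro bounded_linear_compose[OF bounded_linear_inner_left] blinfun.bounded_linear_right)
  then obtain B where B: "\<And>v w. inner (blinfun_apply a v) w = inner v (B w)" by metis
  have BC: "cinner (blinfun_apply a v) w = cinner v (B w)" for v w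
  proof (rule complex_eqI)
    show "Re (cinner (blinfun_apply a v) w) = Re (cinner v (B w))"
      using B by (simp add: inner_eq_Re_cinner)
    have "Re (cinner (blinfun_apply a (\<i> *\<^sub>C v)) w) = Re (cinner (\<i> *\<^sub>C v) (B w))"
      using B by (simp add: inner_eq_Re_cinner)
    then show "Im (cinner (blinfun_apply a v) w) = Im (cinner v (B w))"
      by (simp add: lin cinner_scaleC_left)
  qed
  have eqI: "x = y" if "\<And>v. inner v x = inner v y" for x y :: 'a
    using that by (metis vector_eq_ldot)
  have bl: "bounded_linear B"
  proof (rule bounded_linear_intro[where K = "norm a"])
    show "B (x + y) = B x + B y" for x y
      by (rule eqI) (simp add: B[symmetric] inner_add_right)
    show "B (r *\<^sub>R x) = r *\<^sub>R B x" for r x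
      by (rule eqI) (simp add: B[symmetric])
    show "norm (B w) \<le> norm w * norm a" for w
    proof (cases "B w = 0")
      case False
      have "norm (B w) * norm (B w) = inner (blinfun_apply a (B w)) w"
        by (simp add: B power2_norm_eq_inner[symmetric] power2_eq_square[symmetric])
      also have "\<dots> \<le> norm (blinfun_apply a (B w)) * norm w" by (rule norm_cauchy_schwarz)
      also have "\<dots> \<le> (norm a * norm (B w)) * norm w"
        by (intro mult_right_mono norm_blinfun norm_ge_zero)
      finally have "norm (B w) * norm (B w) \<le> (norm w * norm a) * norm (B w)"
        by (simp add: mult_ac)
      then show ?thesis using False by (simp add: mult_le_cancel_right)
    qed simp
  qed
  have "adj a = Blinfun B"
    unfolding adj_def
  proof (rule the_equality)
    show "\<forall>v w. cinner (blinfun_apply a v) w = cinner v (blinfun_apply (Blinfun B) w)"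
      by (simp add: bounded_linear_Blinfun_apply[OF bl] BC)
    fix b assume "\<forall>v w. cinner (blinfun_apply a v) w = cinner v (blinfun_apply b w)"
    then show "b = Blinfun B"
      by (intro blinfun_eqI eqI) (simp add: bounded_linear_Blinfun_apply[OF bl] inner_eq_Re_cinner flip: BC)
  qed
  then show ?thesis by (simp add: bounded_linear_Blinfun_apply[OF bl] BC)
qed

end

theory Submission
  imports Defs
begin

text \<open>
  The theorem rests on two facts: the algebra \<open>BD\<close> is the multiplier algebra of the Roe algebra inside
  the bounded operators, and every automorphism of the Roe algebra is implemented by a unitary.

  \<^emph>\<open>Spatial implementation\<close> (\<open>star_automorphism_spatial\<close>).  The Roe algebra \<open>A\<close> contains all
  rank-one operators.  An automorphism \<open>\<Phi>\<close> takes a rank-one projection \<open>p\<close>, which satisfies $pAp = \mathbf{C}p$,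
  to a projection \<open>q\<close> with $qAq = \mathbf{C}q$.  As $qAq$ contains the compression to \<open>q\<close> of every
  rank-one operator, \<open>q\<close> has rank one again.  If \<open>e\<close> and \<open>f\<close> are unit vectors in the ranges
  of \<open>p\<close> and \<open>q\<close>, then sending \<open>v\<close> to $\Phi(v \otimes e^*) f$ defines a unitary \<open>u\<close>
  with $\Phi(a) = u a u^*$.

  \<^emph>\<open>Multipliers\<close> (\<open>multiplier_of_Roe_in_BD\<close>).  Let \<open>m\<close> multiply the Roe algebra into \<open>BD\<close> from both
  sides.  Block-diagonal operators \<open>d\<close> whose blocks are finite-rank projections lie in the Roe
  algebra, so that each \<open>d m\<close> is close to an operator of finite propagation.  The crucial point is
  that for a given error one propagation bound serves all \<open>d\<close> (\<open>multiplier_uniformly_near_band\<close>).  Otherwise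
  there is a bad \<open>d\<close> for each bound; after cutting the bad operators down to the complements
  of larger and larger balls, only finitely many of them are nonzero at any given point of \<open>X\<close>, so
  that a single block-diagonal finite-rank projection dominates all of them, and its product with
  \<open>m\<close> is not in \<open>BD\<close>.  Cutting down is harmless because rows of \<open>m\<close> over a ball can be approximated
  (\<open>multiplier_rows_near_band\<close>), by the same domination argument applied on the other side
  of \<open>m\<close>.  Finally the \<open>d\<close> converge strongly to the identity, and a weak cluster point of the
  approximants of \<open>d m\<close>, which exists by Tychonoff's theorem
  (\<open>bounded_operators_weak_cluster_point\<close>), has the same propagation bound and approximates \<open>m\<close>.

  \<^emph>\<open>Conclusion.\<close>  If $\Phi = \mathrm{Ad}(u)$ on the Roe algebra and \<open>m\<close> is in \<open>BD\<close>, then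
  $u m u^*$ multiplies the Roe algebra into itself, hence lies in \<open>BD\<close> (\<open>Ad_BD\<close>).  The same holds for
  $u^*$, so $\mathrm{Ad}(u)$ is an automorphism of \<open>BD\<close>, and
  $\Phi \circ \mathrm{Ad}(v) \circ \Phi^{-1} = \mathrm{Ad}(u v u^*)$ with $u v u^*$ a unitary of \<open>BD\<close>.
\<close>

section \<open>Complex-linear operators and their adjoints\<close>

lemma cinner_simps [simp]:
  fixes x y z :: "'a::complex_hilbert_space"
  shows "cinner 0 y = 0" "cinner x 0 = 0"
    "cinner (- x) y = - cinner x y" "cinner x (- y) = - cinner x y"
    "cinner (x - y) z = cinner x z - cinner y z"
    "cinner x (y - z) = cinner x y - cinner x z"
proof -
  have m: "cinner (- x) y = - cinner x y" for x y :: 'a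
    using cinner_scaleC_left[of "- 1" x y] by (simp add: scaleC_minus_one)
  have m': "cinner x (- y) = - cinner x y" for x y :: 'a
    using cinner_scaleC_right[of x "- 1" y] by (simp add: scaleC_minus_one)
  show "cinner 0 y = 0" using cinner_add_left[of 0 0 y] by simp
  show "cinner x 0 = 0" using cinner_add_right[of x 0 0] by simp
  show "cinner (- x) y = - cinner x y" by (rule m)
  show "cinner x (- y) = - cinner x y" by (rule m')
  show "cinner (x - y) z = cinner x z - cinner y z"
    using cinner_add_left[of x "- y" z] by (simp add: m)
  show "cinner x (y - z) = cinner x y - cinner x z"
    using cinner_add_right[of x y "- z"] by (simp add: m')
qed

lemma cinner_sum_left: "cinner (\<Sum>i\<in>I. f i) y = (\<Sum>i\<in>I. cinner (f i) (y :: 'a::complex_hilbert_space))"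
  by (induction I rule: infinite_finite_induct) (simp_all add: cinner_add_left)

lemma scaleC_zero [simp]:
  fixes x :: "'a::complex_hilbert_space"
  shows "0 *\<^sub>C x = 0" "c *\<^sub>C (0::'a) = 0"
  using norm_scaleC[of 0 x] norm_scaleC[of c "0::'a"] by simp_all

lemma scaleC_minus_right: "c *\<^sub>C (- x) = - (c *\<^sub>C (x :: 'a::complex_vector))"
  using scaleC_scaleC[of c "-1" x] scaleC_scaleC[of "-1" c x] by (simp add: scaleC_minus_one)

lemma scaleC_diff_right: "c *\<^sub>C (x - y) = c *\<^sub>C x - c *\<^sub>C (y :: 'a::complex_vector)"
  using scaleC_add_right[of c x "- y"] by (simp add: scaleC_minus_right)

lemma cinner_ext_right:
  assumes "\<And>w. cinner w u = cinner w v"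
  shows "u = (v :: 'a::complex_hilbert_space)"
  by (rule cinner_ext) (metis assms cinner_commute)

lemma clinear_operatorsD:
  "a \<in> clinear_operators \<Longrightarrow> blinfun_apply a (c *\<^sub>C v) = c *\<^sub>C blinfun_apply a v"
  by (simp add: clinear_operators_def)

lemma clinear_operators_id [simp]: "id_blinfun \<in> clinear_operators"
  by (simp add: clinear_operators_def)

lemma clinear_operators_zero [simp]: "0 \<in> clinear_operators"
  by (simp add: clinear_operators_def)

lemma clinear_operators_add: "a \<in> clinear_operators \<Longrightarrow> b \<in> clinear_operators \<Longrightarrow> a + b \<in> clinear_operators"
  by (simp add: clinear_operators_def blinfun.add_left scaleC_add_right)

lemma clinear_operators_diff: "a \<in> clinear_operators \<Longrightarrow> b \<in> clinear_operators \<Longrightarrow> a - b \<in> clinear_operators"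
  by (simp add: clinear_operators_def blinfun.diff_left scaleC_diff_right)

lemma clinear_operators_sum:
  "(\<And>i. i \<in> I \<Longrightarrow> f i \<in> clinear_operators) \<Longrightarrow> (\<Sum>i\<in>I. f i) \<in> clinear_operators"
  by (induction I rule: infinite_finite_induct) (simp_all add: clinear_operators_add)

lemma clinear_operators_scaleC: "a \<in> clinear_operators \<Longrightarrow> c *\<^sub>C a \<in> clinear_operators"
  by (simp add: clinear_operators_def scaleC_blinfun.rep_eq scaleC_scaleC mult.commute)

lemma clinear_operators_compose:
  "a \<in> clinear_operators \<Longrightarrow> b \<in> clinear_operators \<Longrightarrow> a o\<^sub>L b \<in> clinear_operators"
  by (simp add: clinear_operators_def)

lemma closed_clinear_operators:
  "closed (clinear_operators :: ('a::complex_hilbert_space \<Rightarrow>\<^sub>L 'b::complex_hilbert_space) set)"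
proof -
  let ?E = "\<lambda>c v. {a :: 'a \<Rightarrow>\<^sub>L 'b. blinfun_apply a (c *\<^sub>C v) = c *\<^sub>C blinfun_apply a v}"
  have "closed (?E c v)" for c v
    by (intro closed_Collect_eq continuous_intros
        bounded_linear.continuous_on[OF bounded_linear_scaleC])
  then have "closed (\<Inter>c. \<Inter>v. ?E c v)"
    by (intro closed_INT ballI)
  also have "(\<Inter>c. \<Inter>v. ?E c v) = clinear_operators"
    by (auto simp: clinear_operators_def)
  finally show ?thesis .
qed

lemma adj_eqI:
  assumes "\<And>v w. cinner (blinfun_apply a v) w = cinner v (blinfun_apply b w)"
  shows "adj a = b"
  unfolding adj_def
proof (rule the_equality)
  fix b' assume "\<forall>v w. cinner (blinfun_apply a v) w = cinner v (blinfun_apply b' w)"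
  then show "b' = b"
    using assms by (intro blinfun_eqI cinner_ext_right) simp
qed (use assms in blast)

lemma adj_cinner':
  assumes "a \<in> clinear_operators"
  shows "cinner (blinfun_apply (adj a) v) w = cinner v (blinfun_apply a w)"
  by (metis adj_cinner[OF assms] cinner_commute)

lemma clinear_operators_adj:
  assumes "a \<in> clinear_operators" shows "adj a \<in> clinear_operators"
proof -
  have "blinfun_apply (adj a) (c *\<^sub>C v) = c *\<^sub>C blinfun_apply (adj a) v" for c v
    by (rule cinner_ext) (simp add: adj_cinner'[OF assms] cinner_scaleC_left)
  then show ?thesis by (simp add: clinear_operators_def)
qed

lemma adj_adj: "a \<in> clinear_operators \<Longrightarrow> adj (adj a) = a"
  by (rule adj_eqI) (simp add: adj_cinner')

lemma adj_compose:
  "a \<in> clinear_operators \<Longrightarrow> b \<in> clinear_operators \<Longrightarrow> adj (a o\<^sub>L b) = adj b o\<^sub>L adj a"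
  by (rule adj_eqI) (simp add: adj_cinner)

lemma adj_add: "a \<in> clinear_operators \<Longrightarrow> b \<in> clinear_operators \<Longrightarrow> adj (a + b) = adj a + adj b"
  by (rule adj_eqI) (simp add: blinfun.add_left cinner_add_left cinner_add_right adj_cinner)

lemma adj_diff: "a \<in> clinear_operators \<Longrightarrow> b \<in> clinear_operators \<Longrightarrow> adj (a - b) = adj a - adj b"
  by (rule adj_eqI) (simp add: blinfun.diff_left adj_cinner)

lemma adj_sum: "(\<And>i. i \<in> I \<Longrightarrow> f i \<in> clinear_operators) \<Longrightarrow> adj (\<Sum>i\<in>I. f i) = (\<Sum>i\<in>I. adj (f i))"
proof (induction I rule: infinite_finite_induct)
  case (insert x F)
  then show ?case by (simp add: adj_add clinear_operators_sum)
qed (simp_all add: adj_eqI[of 0 0])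

lemma adj_id [simp]: "adj id_blinfun = id_blinfun"
  by (rule adj_eqI) simp

lemma norm_adj_le:
  assumes "a \<in> clinear_operators" shows "norm (adj a) \<le> norm a"
proof (rule norm_blinfun_bound)
  fix w
  let ?u = "blinfun_apply (adj a) w"
  have "norm ?u * norm ?u = inner ?u ?u"
    by (simp add: power2_norm_eq_inner[symmetric] power2_eq_square)
  also have "\<dots> = inner w (blinfun_apply a ?u)"
    by (simp add: inner_eq_Re_cinner adj_cinner'[OF assms])
  also have "\<dots> \<le> norm w * (norm a * norm ?u)"
    by (rule order_trans[OF norm_cauchy_schwarz mult_left_mono[OF norm_blinfun]]) simp
  finally have "norm ?u * norm ?u \<le> (norm a * norm w) * norm ?u" by (simp add: mult_ac)
  then show "norm ?u \<le> norm a * norm w"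
    by (cases "?u = 0") (simp_all add: mult_le_cancel_right)
qed simp

lemma blinfun_compose_scaleC:
  "a \<in> clinear_operators \<Longrightarrow> a o\<^sub>L (c *\<^sub>C b) = c *\<^sub>C (a o\<^sub>L b)"
  "(c *\<^sub>C a) o\<^sub>L b = c *\<^sub>C (a o\<^sub>L b)"
  by (rule blinfun_eqI, simp add: scaleC_blinfun.rep_eq clinear_operatorsD)+

section \<open>Compact operators\<close>

lemma compact_operator_iff_totally_bounded:
  fixes a :: "'a::real_normed_vector \<Rightarrow>\<^sub>L 'b::{real_normed_vector, complete_space}"
  shows "compact_operator a \<longleftrightarrow>
    (\<forall>e>0. \<exists>K. finite K \<and> (\<forall>v. norm v \<le> 1 \<longrightarrow> (\<exists>k\<in>K. norm (blinfun_apply a v - k) < e)))"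
proof
  assume "compact_operator a"
  then have "\<forall>e>0. \<exists>K. finite K \<and> closure (blinfun_apply a ` cball 0 1) \<subseteq> (\<Union>x\<in>K. ball x e)"
    unfolding compact_operator_def compact_eq_totally_bounded by blast
  moreover have "blinfun_apply a v \<in> closure (blinfun_apply a ` cball 0 1)" if "norm v \<le> 1" for v
    using that by (intro subsetD[OF closure_subset]) auto
  ultimately show "\<forall>e>0. \<exists>K. finite K \<and>
      (\<forall>v. norm v \<le> 1 \<longrightarrow> (\<exists>k\<in>K. norm (blinfun_apply a v - k) < e))"
    by (metis (no_types, lifting) UN_E dist_norm mem_ball norm_minus_commute subsetD)
next
  assume *: "\<forall>e>0. \<exists>K. finite K \<and>
      (\<forall>v. norm v \<le> 1 \<longrightarrow> (\<exists>k\<in>K. norm (blinfun_apply a v - k) < e))"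
  show "compact_operator a"
    unfolding compact_operator_def compact_eq_totally_bounded
  proof (intro conjI allI impI)
    show "complete (closure (blinfun_apply a ` cball 0 1))"
      by (simp add: complete_eq_closed)
    fix e :: real assume e: "e > 0"
    then obtain K where K: "finite K"
      "\<And>v. norm v \<le> 1 \<Longrightarrow> \<exists>k\<in>K. norm (blinfun_apply a v - k) < e/2"
      using *[rule_format, of "e/2"] by auto
    have "blinfun_apply a ` cball 0 1 \<subseteq> (\<Union>x\<in>K. cball x (e/2))"
      using K(2) by (force simp: dist_norm norm_minus_commute)
    then have "closure (blinfun_apply a ` cball 0 1) \<subseteq> (\<Union>x\<in>K. cball x (e/2))"
      using K(1) by (intro closure_minimal closed_UN) auto
    also have "\<dots> \<subseteq> (\<Union>x\<in>K. ball x e)" using e by fastforce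
    finally show "\<exists>K. finite K \<and> closure (blinfun_apply a ` cball 0 1) \<subseteq> (\<Union>x\<in>K. ball x e)"
      using K(1) by blast
  qed
qed

lemma compact_operator_closed:
  fixes a :: "'a::real_normed_vector \<Rightarrow>\<^sub>L 'b::{real_normed_vector, complete_space}"
  assumes "\<And>e. e > 0 \<Longrightarrow> \<exists>b. compact_operator b \<and> norm (a - b) < e"
  shows "compact_operator a"
  unfolding compact_operator_iff_totally_bounded
proof (intro allI impI)
  fix e :: real assume e: "e > 0"
  then obtain b where b: "compact_operator b" "norm (a - b) < e/2"
    using assms[of "e/2"] by auto
  then obtain K where K: "finite K" "\<And>v. norm v \<le> 1 \<Longrightarrow> \<exists>k\<in>K. norm (blinfun_apply b v - k) < e/2"
    using e unfolding compact_operator_iff_totally_bounded by (meson half_gt_zero)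
  have "\<exists>k\<in>K. norm (blinfun_apply a v - k) < e" if v: "norm v \<le> 1" for v
  proof -
    obtain k where k: "k \<in> K" "norm (blinfun_apply b v - k) < e/2" using K(2)[OF v] by blast
    have "norm (blinfun_apply a v - blinfun_apply b v) \<le> norm (a - b) * norm v"
      using norm_blinfun[of "a - b" v] by (simp add: blinfun.diff_left)
    also have "\<dots> \<le> norm (a - b)" using v by (simp add: mult_left_le)
    finally have "norm (blinfun_apply a v - k) < e"
      using k(2) b(2) norm_triangle_ineq[of "blinfun_apply a v - blinfun_apply b v" "blinfun_apply b v - k"]
      by simp
    with k(1) show ?thesis by blast
  qed
  with K(1) show "\<exists>K. finite K \<and> (\<forall>v. norm v \<le> 1 \<longrightarrow> (\<exists>k\<in>K. norm (blinfun_apply a v - k) < e))"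
    by blast
qed

lemma compact_operator_zero [simp]: "compact_operator 0"
proof -
  have "blinfun_apply (0 :: 'a \<Rightarrow>\<^sub>L 'b) ` cball 0 1 = {0}"
    by (auto simp: image_iff intro!: exI[of _ 0])
  then show ?thesis by (simp add: compact_operator_def)
qed

lemma compact_operator_add:
  fixes a b :: "'a::real_normed_vector \<Rightarrow>\<^sub>L 'b::{real_normed_vector, complete_space}"
  assumes "compact_operator a" "compact_operator b"
  shows "compact_operator (a + b)"
  unfolding compact_operator_iff_totally_bounded
proof (intro allI impI)
  fix e :: real assume "e > 0"
  then have e: "e/2 > 0" by simp
  obtain K where K: "finite K" "\<And>v. norm v \<le> 1 \<Longrightarrow> \<exists>k\<in>K. norm (blinfun_apply a v - k) < e/2"
    using e assms(1) unfolding compact_operator_iff_totally_bounded by meson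
  obtain L where L: "finite L" "\<And>v. norm v \<le> 1 \<Longrightarrow> \<exists>k\<in>L. norm (blinfun_apply b v - k) < e/2"
    using e assms(2) unfolding compact_operator_iff_totally_bounded by meson
  have "\<exists>k\<in>(\<lambda>(k, l). k + l) ` (K \<times> L). norm (blinfun_apply (a + b) v - k) < e" if v: "norm v \<le> 1" for v
  proof -
    obtain k l where kl: "k \<in> K" "l \<in> L" "norm (blinfun_apply a v - k) < e/2" "norm (blinfun_apply b v - l) < e/2"
      using K(2)[OF v] L(2)[OF v] by blast
    have "norm (blinfun_apply (a + b) v - (k + l)) < e"
      using kl(3,4) norm_triangle_ineq[of "blinfun_apply a v - k" "blinfun_apply b v - l"]
      by (simp add: blinfun.add_left algebra_simps)
    with kl(1,2) show ?thesis by force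
  qed
  then show "\<exists>K. finite K \<and> (\<forall>v. norm v \<le> 1 \<longrightarrow> (\<exists>k\<in>K. norm (blinfun_apply (a + b) v - k) < e))"
    using K(1) L(1) by (intro exI[of _ "(\<lambda>(k, l). k + l) ` (K \<times> L)"]) simp
qed

lemma compact_operator_sum:
  fixes f :: "'i \<Rightarrow> ('a::real_normed_vector \<Rightarrow>\<^sub>L 'b::{real_normed_vector, complete_space})"
  shows "(\<And>i. i \<in> I \<Longrightarrow> compact_operator (f i)) \<Longrightarrow> compact_operator (\<Sum>i\<in>I. f i)"
  by (induction I rule: infinite_finite_induct) (simp_all add: compact_operator_add)

lemma compact_operator_compose_left:
  fixes a :: "'a::real_normed_vector \<Rightarrow>\<^sub>L 'b::{real_normed_vector, complete_space}"
    and b :: "'b \<Rightarrow>\<^sub>L 'c::{real_normed_vector, complete_space}"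
  assumes "compact_operator a"
  shows "compact_operator (b o\<^sub>L a)"
  unfolding compact_operator_iff_totally_bounded
proof (intro allI impI)
  fix e :: real assume e: "e > 0"
  define d where "d = e / (norm b + 1)"
  have d: "d > 0" using e by (simp add: d_def add_nonneg_pos)
  obtain K where K: "finite K" "\<And>v. norm v \<le> 1 \<Longrightarrow> \<exists>k\<in>K. norm (blinfun_apply a v - k) < d"
    using d assms unfolding compact_operator_iff_totally_bounded by meson
  have "\<exists>k\<in>blinfun_apply b ` K. norm (blinfun_apply (b o\<^sub>L a) v - k) < e" if v: "norm v \<le> 1" for v
  proof -
    obtain k where k: "k \<in> K" "norm (blinfun_apply a v - k) < d" using K(2)[OF v] by blast
    have "norm (blinfun_apply b (blinfun_apply a v) - blinfun_apply b k) \<le> norm b * norm (blinfun_apply a v - k)"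
      using norm_blinfun[of b "blinfun_apply a v - k"] by (simp add: blinfun.diff_right)
    also have "\<dots> \<le> norm b * d" using k(2) by (intro mult_left_mono) auto
    also have "\<dots> < (norm b + 1) * d" using d by (simp add: algebra_simps)
    also have "\<dots> = e" using add_nonneg_pos[OF norm_ge_zero[of b] zero_less_one] by (simp add: d_def)
    finally show ?thesis using k(1) by auto
  qed
  then show "\<exists>K. finite K \<and> (\<forall>v. norm v \<le> 1 \<longrightarrow> (\<exists>k\<in>K. norm (blinfun_apply (b o\<^sub>L a) v - k) < e))"
    using K(1) by (intro exI[of _ "blinfun_apply b ` K"]) simp
qed

lemma compact_operator_compose_right:
  fixes a :: "'a::real_normed_vector \<Rightarrow>\<^sub>L 'b::{real_normed_vector, complete_space}"
    and b :: "'c::real_normed_vector \<Rightarrow>\<^sub>L 'a"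
  assumes "compact_operator a"
  shows "compact_operator (a o\<^sub>L b)"
  unfolding compact_operator_iff_totally_bounded
proof (intro allI impI)
  fix e :: real assume e: "e > 0"
  define c where "c = norm b + 1"
  have c: "c > 0" by (simp add: c_def add_nonneg_pos)
  obtain K where K: "finite K" "\<And>v. norm v \<le> 1 \<Longrightarrow> \<exists>k\<in>K. norm (blinfun_apply a v - k) < e / c"
    using e c assms unfolding compact_operator_iff_totally_bounded by (meson divide_pos_pos)
  have "\<exists>k\<in>(*\<^sub>R) c ` K. norm (blinfun_apply (a o\<^sub>L b) v - k) < e" if v: "norm v \<le> 1" for v
  proof -
    have "norm (blinfun_apply b v) \<le> norm b * norm v" by (rule norm_blinfun)
    also have "\<dots> \<le> norm b * 1" using v by (intro mult_left_mono) auto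
    finally have "norm (blinfun_apply b v /\<^sub>R c) \<le> 1" using c by (simp add: c_def field_simps)
    then obtain k where k: "k \<in> K" "norm (blinfun_apply a (blinfun_apply b v /\<^sub>R c) - k) < e / c"
      using K(2) by blast
    have "blinfun_apply (a o\<^sub>L b) v - c *\<^sub>R k = c *\<^sub>R (blinfun_apply a (blinfun_apply b v /\<^sub>R c) - k)"
      using c by (simp add: blinfun.scaleR_right scaleR_diff_right)
    then have "norm (blinfun_apply (a o\<^sub>L b) v - c *\<^sub>R k) = c * norm (blinfun_apply a (blinfun_apply b v /\<^sub>R c) - k)"
      using c by (simp only: norm_scaleR abs_of_pos)
    also have "\<dots> < e" using c k(2) by (simp only: pos_less_divide_eq mult.commute)
    finally have "norm (blinfun_apply (a o\<^sub>L b) v - c *\<^sub>R k) < e" .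
    then show ?thesis using k(1) by auto
  qed
  then show "\<exists>K. finite K \<and> (\<forall>v. norm v \<le> 1 \<longrightarrow> (\<exists>k\<in>K. norm (blinfun_apply (a o\<^sub>L b) v - k) < e))"
    using K(1) by (intro exI[of _ "(*\<^sub>R) c ` K"]) simp
qed

lemma compact_operator_scaleC:
  fixes a :: "'a::complex_hilbert_space \<Rightarrow>\<^sub>L 'b::complex_hilbert_space"
  assumes "compact_operator a" shows "compact_operator (c *\<^sub>C a)"
proof -
  have "c *\<^sub>C a = (c *\<^sub>C id_blinfun) o\<^sub>L a"
    by (rule blinfun_eqI) (simp add: scaleC_blinfun.rep_eq)
  then show ?thesis using compact_operator_compose_left[OF assms] by metis
qed

text \<open>Schauder's theorem in the Hilbert space case: for a vector \<open>w\<close> of bounded norm,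
  $\|a^* w\|^2 = \langle w, a a^* w\rangle$ is controlled by $\|a a^* w\|$, so total boundedness passes from
  the image of the unit ball under $a a^*$ to the image under $a^*$.\<close>

lemma compact_operator_adj:
  fixes a :: "'a::complex_hilbert_space \<Rightarrow>\<^sub>L 'b::complex_hilbert_space"
  assumes a: "a \<in> clinear_operators" "compact_operator a"
  shows "compact_operator (adj a)"
  unfolding compact_operator_iff_totally_bounded
proof (intro allI impI)
  fix e :: real assume e: "e > 0"
  then have d: "e\<^sup>2 / 4 > 0" by simp
  have "compact_operator (a o\<^sub>L adj a)"
    by (rule compact_operator_compose_right[OF a(2)])
  then obtain K where K: "finite K"
      "\<And>v. norm v \<le> 1 \<Longrightarrow> \<exists>k\<in>K. norm (blinfun_apply (a o\<^sub>L adj a) v - k) < e\<^sup>2 / 4"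
    using d unfolding compact_operator_iff_totally_bounded by meson
  \<comment> \<open>The points of \<open>K\<close> need not lie in the range of \<open>a a*\<close>; the net for \<open>adj a\<close> is made of the images
    of representatives \<open>r k\<close> that \<open>a a*\<close> maps close to \<open>k\<close>.\<close>
  define r where "r k = (SOME v. norm v \<le> 1 \<and> norm (blinfun_apply (a o\<^sub>L adj a) v - k) < e\<^sup>2 / 4)" for k
  have "\<exists>k\<in>(\<lambda>k. blinfun_apply (adj a) (r k)) ` K. norm (blinfun_apply (adj a) v - k) < e"
    if v: "norm v \<le> 1" for v
  proof -
    obtain k where k: "k \<in> K" "norm (blinfun_apply (a o\<^sub>L adj a) v - k) < e\<^sup>2 / 4"
      using K(2)[OF v] by blast
    have r: "norm (r k) \<le> 1 \<and> norm (blinfun_apply (a o\<^sub>L adj a) (r k) - k) < e\<^sup>2 / 4"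
      unfolding r_def by (rule someI[of _ v]) (use v k(2) in simp)
    define w where "w = v - r k"
    have w: "norm w \<le> 2" using norm_triangle_ineq4[of v "r k"] v r by (simp add: w_def)
    have "norm (blinfun_apply (a o\<^sub>L adj a) v - blinfun_apply (a o\<^sub>L adj a) (r k)) < e\<^sup>2 / 4 + e\<^sup>2 / 4"
      using k(2) r norm_triangle_ineq4[of "blinfun_apply (a o\<^sub>L adj a) v - k" "blinfun_apply (a o\<^sub>L adj a) (r k) - k"]
      by simp
    then have aw: "norm (blinfun_apply a (blinfun_apply (adj a) w)) < e\<^sup>2 / 2"
      by (simp add: w_def blinfun.diff_right)
    have "(norm (blinfun_apply (adj a) w))\<^sup>2 = inner w (blinfun_apply a (blinfun_apply (adj a) w))"
      by (simp add: power2_norm_eq_inner inner_eq_Re_cinner adj_cinner'[OF a(1)])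
    also have "\<dots> \<le> norm w * norm (blinfun_apply a (blinfun_apply (adj a) w))"
      by (rule norm_cauchy_schwarz)
    also have "\<dots> \<le> 2 * norm (blinfun_apply a (blinfun_apply (adj a) w))"
      using w by (intro mult_right_mono) auto
    also have "\<dots> < e\<^sup>2" using aw by simp
    finally have "norm (blinfun_apply (adj a) w) < e"
      using e by (simp add: power2_less_imp_less)
    then show ?thesis using k(1) by (auto simp: w_def blinfun.diff_right)
  qed
  then show "\<exists>K. finite K \<and> (\<forall>v. norm v \<le> 1 \<longrightarrow> (\<exists>k\<in>K. norm (blinfun_apply (adj a) v - k) < e))"
    using K(1) by (intro exI[of _ "(\<lambda>k. blinfun_apply (adj a) (r k)) ` K"]) simp
qed

section \<open>Rank-one operators\<close>

lift_definition rank_one :: "'a::complex_hilbert_space \<Rightarrow> 'b::complex_hilbert_space \<Rightarrow> 'b \<Rightarrow>\<^sub>L 'a"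
  is "\<lambda>v w x. cinner x w *\<^sub>C v"
proof -
  fix v :: 'a and w :: 'b
  show "bounded_linear (\<lambda>x. cinner x w *\<^sub>C v)"
  proof (rule bounded_linear_intro[where K = "norm w * norm v"])
    fix x y :: 'b and r :: real
    show "cinner (x + y) w *\<^sub>C v = cinner x w *\<^sub>C v + cinner y w *\<^sub>C v"
      by (simp add: cinner_add_left scaleC_add_left)
    show "cinner (r *\<^sub>R x) w *\<^sub>C v = r *\<^sub>R cinner x w *\<^sub>C v"
      by (simp add: scaleR_scaleC cinner_scaleC_left scaleC_scaleC)
    show "norm (cinner x w *\<^sub>C v) \<le> norm x * (norm w * norm v)"
      using mult_right_mono[OF norm_cinner_le[of x w] norm_ge_zero[of v]]
      by (simp add: norm_scaleC mult.assoc)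
  qed
qed

lemma rank_one_apply: "blinfun_apply (rank_one v w) x = cinner x w *\<^sub>C v"
  by (simp add: rank_one.rep_eq)

lemma clinear_operators_rank_one [simp]: "rank_one v w \<in> clinear_operators"
  by (simp add: clinear_operators_def rank_one_apply cinner_scaleC_left scaleC_scaleC)

lemma norm_rank_one_le: "norm (rank_one v w) \<le> norm v * norm w"
proof (rule norm_blinfun_bound)
  show "norm (blinfun_apply (rank_one v w) x) \<le> norm v * norm w * norm x" for x
    using mult_right_mono[OF norm_cinner_le[of x w] norm_ge_zero[of v]]
    by (simp add: rank_one_apply norm_scaleC mult_ac)
qed simp

lemma adj_rank_one: "adj (rank_one v w) = rank_one w v"
proof (rule adj_eqI)
  show "cinner (blinfun_apply (rank_one v w) x) y = cinner x (blinfun_apply (rank_one w v) y)" for x y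
    by (simp add: rank_one_apply cinner_scaleC_left cinner_scaleC_right cinner_commute[of v y])
qed

lemma rank_one_add_left: "rank_one (u + v) w = rank_one u w + rank_one v w"
  by (rule blinfun_eqI) (simp add: rank_one_apply blinfun.add_left scaleC_add_right)

lemma rank_one_scaleC_left: "rank_one (c *\<^sub>C v) w = c *\<^sub>C rank_one v w"
  by (rule blinfun_eqI) (simp add: rank_one_apply scaleC_blinfun.rep_eq scaleC_scaleC mult.commute)

lemma compose_rank_one:
  assumes "a \<in> clinear_operators"
  shows "a o\<^sub>L rank_one v w = rank_one (blinfun_apply a v) w"
  by (rule blinfun_eqI) (simp add: rank_one_apply clinear_operatorsD[OF assms])

lemma rank_one_compose_rank_one:
  "rank_one v w o\<^sub>L rank_one v' w' = cinner v' w *\<^sub>C rank_one v w'"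
  by (rule blinfun_eqI)
    (simp add: rank_one_apply scaleC_blinfun.rep_eq cinner_scaleC_left scaleC_scaleC mult.commute)

lemma compact_operator_rank_one:
  fixes v :: "'a::complex_hilbert_space" and w :: "'b::complex_hilbert_space"
  shows "compact_operator (rank_one v w)"
proof -
  have "compact ((\<lambda>c. c *\<^sub>C v) ` cball 0 (norm w))"
  proof (rule compact_continuous_image[OF _ compact_cball])
    have "continuous_on UNIV (\<lambda>c. c *\<^sub>C v)"
    proof (rule linear_continuous_on)
      show "bounded_linear (\<lambda>c. c *\<^sub>C v)"
        by (rule bounded_linear_intro[where K = "norm v"])
          (simp_all add: scaleC_add_left scaleR_scaleC scaleC_scaleC norm_scaleC scaleR_conv_of_real)
    qed
    then show "continuous_on (cball 0 (norm w)) (\<lambda>c. c *\<^sub>C v)"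
      by (rule continuous_on_subset) simp
  qed
  moreover have "blinfun_apply (rank_one v w) ` cball 0 1 \<subseteq> (\<lambda>c. c *\<^sub>C v) ` cball 0 (norm w)"
  proof (clarsimp simp: rank_one_apply)
    fix x :: 'b assume "norm x \<le> 1"
    then have "cmod (cinner x w) \<le> norm w"
      using norm_cinner_le[of x w] mult_right_mono[of "norm x" 1 "norm w"] by simp
    then show "cinner x w *\<^sub>C v \<in> (\<lambda>c. c *\<^sub>C v) ` cball 0 (norm w)" by auto
  qed
  ultimately have "closure (blinfun_apply (rank_one v w) ` cball 0 1) \<subseteq> (\<lambda>c. c *\<^sub>C v) ` cball 0 (norm w)"
    by (intro closure_minimal compact_imp_closed)
  with \<open>compact _\<close> show ?thesis
    unfolding compact_operator_def by (metis closed_closure compact_Int_closed inf.absorb_iff2)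
qed

section \<open>Finite-rank projections\<close>

definition orthonormal :: "'a::complex_hilbert_space set \<Rightarrow> bool"
  where "orthonormal S \<longleftrightarrow> (\<forall>e\<in>S. \<forall>f\<in>S. cinner e f = (if e = f then 1 else 0))"

text \<open>For finite orthonormal \<open>S\<close> this is the orthogonal projection onto the span of \<open>S\<close>.\<close>

definition span_proj :: "'a::complex_hilbert_space set \<Rightarrow> 'a \<Rightarrow>\<^sub>L 'a"
  where "span_proj S = (\<Sum>e\<in>S. rank_one e e)"

lemma span_proj_apply: "blinfun_apply (span_proj S) v = (\<Sum>e\<in>S. cinner v e *\<^sub>C e)"
  by (simp add: span_proj_def blinfun.sum_left rank_one_apply)

lemma clinear_operators_span_proj [simp]: "span_proj S \<in> clinear_operators"
  by (simp add: span_proj_def clinear_operators_sum)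

lemma adj_span_proj: "adj (span_proj S) = span_proj S"
  by (simp add: span_proj_def adj_sum adj_rank_one)

lemma compact_operator_span_proj: "compact_operator (span_proj S)"
  unfolding span_proj_def by (rule compact_operator_sum) (rule compact_operator_rank_one)

lemma span_proj_fixes:
  assumes "orthonormal S" "finite S" "e \<in> S"
  shows "blinfun_apply (span_proj S) e = e"
proof -
  have "blinfun_apply (span_proj S) e = (\<Sum>f\<in>S. if e = f then e else 0)"
    unfolding span_proj_apply using assms
    by (intro sum.cong) (auto simp: orthonormal_def scaleC_one)
  then show ?thesis using assms by simp
qed

text \<open>In particular, a projection that fixes the generating vectors dominates the projection onto their
  span.\<close>

lemma compose_span_proj:
  assumes "a \<in> clinear_operators" "\<And>e. e \<in> S \<Longrightarrow> blinfun_apply a e = e"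
  shows "a o\<^sub>L span_proj S = span_proj S"
  by (rule blinfun_eqI)
    (simp add: span_proj_apply blinfun.sum_right clinear_operatorsD[OF assms(1)] assms(2))

lemma span_proj_idem: "orthonormal S \<Longrightarrow> finite S \<Longrightarrow> span_proj S o\<^sub>L span_proj S = span_proj S"
  by (rule compose_span_proj) (simp_all add: span_proj_fixes)

lemma norm_span_proj_le:
  assumes "orthonormal S" "finite S"
  shows "norm (span_proj S) \<le> 1"
proof (rule norm_blinfun_bound)
  fix v
  let ?p = "blinfun_apply (span_proj S)"
  have "norm (?p v) * norm (?p v) = inner (?p v) (?p v)"
    by (simp add: power2_norm_eq_inner[symmetric] power2_eq_square)
  also have "\<dots> = inner v (?p (?p v))"
    using adj_cinner[of "span_proj S" v "?p v"] by (simp add: inner_eq_Re_cinner adj_span_proj)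
  also have "?p (?p v) = ?p v"
    using span_proj_idem[OF assms] by (metis blinfun_apply_blinfun_compose)
  also have "inner v (?p v) \<le> norm v * norm (?p v)" by (rule norm_cauchy_schwarz)
  finally show "norm (?p v) \<le> 1 * norm v"
    by (cases "?p v = 0") (simp_all add: mult_le_cancel_right)
qed simp

text \<open>The Gram-Schmidt process, one vector at a time: if \<open>v\<close> is not yet fixed, normalise its component
  orthogonal to the range of the projection constructed so far and add it to the generators.\<close>

lemma exists_span_proj_fixing:
  assumes "finite (V :: 'a::complex_hilbert_space set)"
  shows "\<exists>S. finite S \<and> orthonormal S \<and> (\<forall>v\<in>V. blinfun_apply (span_proj S) v = v)"
  using assms
proof induction
  case empty
  show ?case by (intro exI[of _ "{}"]) (simp add: orthonormal_def)
next
  case (insert v V)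
  then obtain S where S: "finite S" "orthonormal S" "\<And>v. v \<in> V \<Longrightarrow> blinfun_apply (span_proj S) v = v"
    by blast
  define u where "u = v - blinfun_apply (span_proj S) v"
  show ?case
  proof (cases "u = 0")
    case True
    then show ?thesis using S by (intro exI[of _ S]) (auto simp: u_def)
  next
    case False
    have orth: "cinner u e = 0" if "e \<in> S" for e
      using adj_cinner[of "span_proj S" v e] that
      by (simp add: u_def adj_span_proj span_proj_fixes[OF S(2,1)])
    define n where "n = complex_of_real (inverse (norm u)) *\<^sub>C u"
    have n_S: "cinner n e = 0" "cinner e n = 0" if "e \<in> S" for e
      using orth[OF that] cinner_commute[of e n] by (simp_all add: n_def cinner_scaleC_left)
    have norm_u: "complex_of_real (norm u) \<noteq> 0" using False by simp
    have n_n: "cinner n n = 1"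
      using False by (simp add: cinner_self n_def norm_scaleC del: of_real_inverse)
    then have "n \<notin> S" using n_S(1) by force
    then have P: "blinfun_apply (span_proj (insert n S)) x = cinner x n *\<^sub>C n + blinfun_apply (span_proj S) x" for x
      using S(1) by (simp add: span_proj_apply)
    have "blinfun_apply (span_proj (insert n S)) x = x" if "blinfun_apply (span_proj S) x = x" for x
    proof -
      have "cinner x n = cinner (\<Sum>e\<in>S. cinner x e *\<^sub>C e) n"
        using that by (simp add: span_proj_apply)
      then have "cinner x n = 0" by (simp add: cinner_sum_left cinner_scaleC_left n_S)
      then show ?thesis using that by (simp add: P)
    qed
    moreover have "blinfun_apply (span_proj (insert n S)) v = v"
    proof -
      have "cinner v n = cinner u n + cinner (\<Sum>e\<in>S. cinner v e *\<^sub>C e) n"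
        by (simp add: u_def span_proj_apply)
      also have "cinner (\<Sum>e\<in>S. cinner v e *\<^sub>C e) n = 0"
        by (simp add: cinner_sum_left cinner_scaleC_left n_S)
      finally have "cinner v n *\<^sub>C n = cinner u n *\<^sub>C n" by simp
      also have "\<dots> = (inverse (complex_of_real (norm u)) *
          (complex_of_real (norm u) * complex_of_real (norm u)) * inverse (complex_of_real (norm u))) *\<^sub>C u"
        by (simp add: n_def cinner_scaleC_right cinner_self scaleC_scaleC power2_eq_square)
      also have "\<dots> = u"
        using norm_u by (simp only: field_simps) (simp add: scaleC_one)
      finally have "cinner v n *\<^sub>C n = u" .
      then show ?thesis by (simp add: P u_def)
    qed
    moreover have "orthonormal (insert n S)"
      using S(2) n_S n_n by (auto simp: orthonormal_def)
    ultimately show ?thesis using S(1,3) by (intro exI[of _ "insert n S"]) auto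
  qed
qed

section \<open>Cluster points in the weak operator topology\<close>

lemma inner_ext:
  assumes "\<And>w. inner u w = inner v w"
  shows "u = (v :: 'a::real_inner)"
proof -
  have "inner (u - v) (u - v) = 0"
    using assms[of "u - v"] by (simp only: inner_diff_left[of u v])
  then show ?thesis by simp
qed

text \<open>The real bilinear forms $(v, w) \mapsto \langle b_i v, w\rangle$ live in a product of compact intervals.
  A cluster point of them is again a bounded bilinear form, hence comes from an operator by the
  representation theorem of Riesz.  The cluster point is expressed as a limit along a finer
  proper filter \<open>G\<close>, so that the usual limit rules apply to it.\<close>

lemma bounded_operators_weak_cluster_point:
  fixes b :: "'i \<Rightarrow> ('a::real_normed_vector \<Rightarrow>\<^sub>L 'b::{real_inner, complete_space})"
  assumes F: "F \<noteq> bot" and C: "\<And>i. norm (b i) \<le> C"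
  shows "\<exists>G B. G \<le> F \<and> G \<noteq> bot \<and>
    (\<forall>v w. ((\<lambda>i. inner (blinfun_apply (b i) v) w) \<longlongrightarrow> inner (blinfun_apply B v) w) G)"
proof -
  define \<phi> where "\<phi> i = (\<lambda>(v, w). inner (blinfun_apply (b i) v) w)" for i
  define K where "K = (\<lambda>(v :: 'a, w :: 'b). cball (0::real) (C * norm v * norm w))"
  have \<phi>: "\<phi> i p \<in> K p" for i p
  proof -
    obtain v w where p: "p = (v, w)" by (cases p)
    have "\<bar>inner (blinfun_apply (b i) v) w\<bar> \<le> norm (blinfun_apply (b i) v) * norm w"
      by (rule Cauchy_Schwarz_ineq2)
    also have "\<dots> \<le> (norm (b i) * norm v) * norm w"
      by (intro mult_right_mono norm_blinfun) simp
    also have "\<dots> \<le> (C * norm v) * norm w"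
      by (intro mult_right_mono C) simp_all
    finally show ?thesis by (simp add: p \<phi>_def K_def)
  qed
  have "compactin (product_topology (\<lambda>_. euclidean) UNIV) (PiE UNIV K)"
    by (subst compactin_PiE) (auto simp: K_def)
  then have "compact (PiE UNIV K)"
    by (simp add: euclidean_product_topology)
  moreover have "eventually (\<lambda>f. f \<in> PiE UNIV K) (filtermap \<phi> F)"
    by (simp add: eventually_filtermap PiE_UNIV_domain \<phi>)
  moreover have "filtermap \<phi> F \<noteq> bot" using F by (simp add: filtermap_bot_iff)
  ultimately obtain g where g: "inf (nhds g) (filtermap \<phi> F) \<noteq> bot"
    unfolding compact_filter by blast
  define G where "G = inf F (filtercomap \<phi> (nhds g))"
  have G: "G \<noteq> bot"
  proof
    assume "G = bot"
    then obtain P Q where P: "eventually P F" "eventually Q (nhds g)" "\<And>x. P x \<Longrightarrow> \<not> Q (\<phi> x)"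
      unfolding G_def trivial_limit_def eventually_inf eventually_filtercomap by auto
    from P(1,3) have "eventually (\<lambda>f. \<not> Q f) (filtermap \<phi> F)"
      by (auto simp: eventually_filtermap elim: eventually_mono)
    with P(2) have "eventually (\<lambda>f. False) (inf (nhds g) (filtermap \<phi> F))"
      unfolding eventually_inf by blast
    with g show False by (simp add: trivial_limit_def)
  qed
  have "filterlim \<phi> (nhds g) G"
    unfolding filterlim_def G_def
    by (meson filterlim_def filterlim_filtercomap filterlim_mono inf.cobounded2 order_refl)
  moreover have "((\<lambda>f. f p) \<longlongrightarrow> g p) (nhds g)" for p
  proof (rule topological_tendstoI)
    fix S :: "real set" assume "open S" "g p \<in> S"
    then show "eventually (\<lambda>f. f p \<in> S) (nhds g)"
      using open_vimage[OF \<open>open S\<close> continuous_on_product_coordinates[of p]]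
      unfolding eventually_nhds by (intro exI[of _ "(\<lambda>f. f p) -` S"]) auto
  qed
  ultimately have "((\<lambda>i. \<phi> i p) \<longlongrightarrow> g p) G" for p
    using filterlim_compose by blast
  then have lim: "((\<lambda>i. inner (blinfun_apply (b i) v) w) \<longlongrightarrow> g (v, w)) G" for v w
    using \<phi>_def by (metis (mono_tags, lifting) case_prod_conv tendsto_cong eventuallyI)
  have uniq: "g (v, w) = l" if "((\<lambda>i. inner (blinfun_apply (b i) v) w) \<longlongrightarrow> l) G" for v w l
    by (rule tendsto_unique[OF G lim that])
  have bound: "\<bar>g (v, w)\<bar> \<le> C * norm v * norm w" for v w
  proof (rule tendsto_upperbound[OF tendsto_rabs[OF lim] _ G], intro always_eventually allI)
    show "\<bar>inner (blinfun_apply (b i) v) w\<bar> \<le> C * norm v * norm w" for i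
      using \<phi>[of i "(v, w)"] by (simp add: \<phi>_def K_def)
  qed
  have "\<exists>z. \<forall>w. g (v, w) = inner w z" for v
  proof (rule riesz_representation)
    show "bounded_linear (\<lambda>w. g (v, w))"
    proof (rule bounded_linear_intro[where K = "C * norm v"])
      show "g (v, w + w') = g (v, w) + g (v, w')" for w w'
        by (rule uniq) (simp only: inner_add_right, intro tendsto_add lim)
      show "g (v, r *\<^sub>R w) = r *\<^sub>R g (v, w)" for r w
        by (rule uniq) (simp, intro tendsto_mult_left lim)
      show "norm (g (v, w)) \<le> norm w * (C * norm v)" for w
        using bound[of v w] by (simp add: mult.commute)
    qed
  qed
  then obtain B where B: "\<And>v w. g (v, w) = inner (B v) w" by (metis inner_commute)
  have "bounded_linear B"
  proof (rule bounded_linear_intro[where K = C])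
    show "B (x + y) = B x + B y" for x y
    proof -
      have "inner (B (x + y)) w = inner (B x + B y) w" for w
        unfolding inner_add_left B[symmetric]
        by (rule uniq) (simp only: blinfun.add_right inner_add_left, intro tendsto_add lim)
      then show ?thesis by (rule inner_ext)
    qed
    show "B (r *\<^sub>R x) = r *\<^sub>R B x" for r x
    proof -
      have "inner (B (r *\<^sub>R x)) w = inner (r *\<^sub>R B x) w" for w
        unfolding inner_scaleR_left B[symmetric]
        by (rule uniq) (simp add: blinfun.scaleR_right, intro tendsto_mult_left lim)
      then show ?thesis by (rule inner_ext)
    qed
    show "norm (B x) \<le> norm x * C" for x
    proof -
      have "norm (B x) * norm (B x) = g (x, B x)"
        by (simp add: B power2_norm_eq_inner[symmetric] power2_eq_square)
      also have "\<dots> \<le> (norm x * C) * norm (B x)"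
        using bound[of x "B x"] by (simp add: mult.commute)
      finally have *: "norm (B x) * norm (B x) \<le> (norm x * C) * norm (B x)" .
      have "0 \<le> C" using C order_trans norm_ge_zero by blast
      with * show ?thesis by (cases "B x = 0") (simp_all add: mult_le_cancel_right)
    qed
  qed
  then have "inner (blinfun_apply (Blinfun B) v) w = g (v, w)" for v w
    by (simp add: bounded_linear_Blinfun_apply B)
  with lim G show ?thesis
    by (intro exI[of _ G] exI[of _ "Blinfun B"]) (simp add: G_def)
qed

lemma weak_limit_norm_le:
  fixes b :: "'i \<Rightarrow> ('a::real_normed_vector \<Rightarrow>\<^sub>L 'b::real_inner)"
  assumes "G \<noteq> bot"
    and lim: "\<And>v w. ((\<lambda>i. inner (blinfun_apply (b i) v) w) \<longlongrightarrow> inner (blinfun_apply B v) w) G"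
    and le: "\<And>i. norm (b i) \<le> e"
  shows "norm B \<le> e"
proof (rule norm_blinfun_bound)
  have e: "0 \<le> e" using le order_trans norm_ge_zero by blast
  then show "0 \<le> e" .
  fix v
  let ?B = "blinfun_apply B v"
  have "inner ?B ?B \<le> e * norm v * norm ?B"
  proof (rule tendsto_upperbound[OF lim _ \<open>G \<noteq> bot\<close>], intro always_eventually allI)
    fix i
    have "inner (blinfun_apply (b i) v) ?B \<le> norm (blinfun_apply (b i) v) * norm ?B"
      by (rule norm_cauchy_schwarz)
    also have "\<dots> \<le> (norm (b i) * norm v) * norm ?B"
      by (intro mult_right_mono norm_blinfun) simp
    also have "\<dots> \<le> (e * norm v) * norm ?B"
      by (intro mult_right_mono le) simp_all
    finally show "inner (blinfun_apply (b i) v) ?B \<le> e * norm v * norm ?B" .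
  qed
  then have "norm ?B * norm ?B \<le> (e * norm v) * norm ?B"
    by (simp add: power2_norm_eq_inner[symmetric] power2_eq_square)
  then show "norm ?B \<le> e * norm v"
    using e by (cases "?B = 0") (simp_all add: mult_le_cancel_right)
qed

lemma weak_limit_clinear_operators:
  fixes b :: "'i \<Rightarrow> ('a::complex_hilbert_space \<Rightarrow>\<^sub>L 'b::complex_hilbert_space)"
  assumes "G \<noteq> bot"
    and lim: "\<And>v w. ((\<lambda>i. inner (blinfun_apply (b i) v) w) \<longlongrightarrow> inner (blinfun_apply B v) w) G"
    and "\<And>i. b i \<in> clinear_operators"
  shows "B \<in> clinear_operators"
proof -
  have i: "inner (c *\<^sub>C x) y = inner x (cnj c *\<^sub>C y)" for c and x y :: 'b
    by (simp add: inner_eq_Re_cinner cinner_scaleC_left cinner_scaleC_right)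
  have "inner (blinfun_apply B (c *\<^sub>C v)) w = inner (c *\<^sub>C blinfun_apply B v) w" for c v w
    using tendsto_unique[OF assms(1) lim[of "c *\<^sub>C v" w]] lim[of v "cnj c *\<^sub>C w"]
    by (simp add: clinear_operatorsD[OF assms(3)] i)
  then have "blinfun_apply B (c *\<^sub>C v) = c *\<^sub>C blinfun_apply B v" for c v
    by (rule inner_ext)
  then show ?thesis by (simp add: clinear_operators_def)
qed

section \<open>Block-diagonal operators\<close>

lemma ell2_eqI: "(\<And>x. Rep_ell2 f x = Rep_ell2 g x) \<Longrightarrow> f = g"
  by (simp add: Rep_ell2_inject[symmetric] fun_eq_iff)

lemma summable_on_Rep_ell2: "(\<lambda>x. (norm (Rep_ell2 f x))\<^sup>2) summable_on A"
  by (rule summable_on_subset_banach[of _ UNIV]) (use Rep_ell2[of f] in auto)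

text \<open>Meant for families of contractions \<open>t\<close>: only a bound on the norms of the blocks ensures that the
  pointwise application of \<open>t\<close> stays square-summable.\<close>

definition diag_op :: "('x \<Rightarrow> 'h \<Rightarrow>\<^sub>L 'h) \<Rightarrow> ('x, 'h::complex_hilbert_space) ell2 \<Rightarrow>\<^sub>L ('x, 'h) ell2"
  where "diag_op t = Blinfun (\<lambda>f. Abs_ell2 (\<lambda>x. blinfun_apply (t x) (Rep_ell2 f x)))"

context
  fixes t :: "'x \<Rightarrow> 'h \<Rightarrow>\<^sub>L 'h::complex_hilbert_space"
  assumes t: "\<And>x. norm (t x) \<le> 1"
begin

lemma diag_op_pointwise_le: "norm (blinfun_apply (t x) v) \<le> norm v"
  using order_trans[OF norm_blinfun mult_right_mono[OF t norm_ge_zero]] by simp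

private lemma Rep_Abs:
  "Rep_ell2 (Abs_ell2 (\<lambda>x. blinfun_apply (t x) (Rep_ell2 f x))) = (\<lambda>x. blinfun_apply (t x) (Rep_ell2 f x))"
proof (rule Abs_ell2_inverse, rule CollectI, rule summable_on_comparison_test)
  show "(\<lambda>x. (norm (Rep_ell2 f x))\<^sup>2) summable_on UNIV" by (rule summable_on_Rep_ell2)
  show "(norm (blinfun_apply (t x) (Rep_ell2 f x)))\<^sup>2 \<le> (norm (Rep_ell2 f x))\<^sup>2" for x
    by (intro power_mono diag_op_pointwise_le) simp
qed simp

private lemma norm_le: "norm (Abs_ell2 (\<lambda>x. blinfun_apply (t x) (Rep_ell2 f x))) \<le> norm f"
proof -
  have "(norm (Abs_ell2 (\<lambda>x. blinfun_apply (t x) (Rep_ell2 f x))))\<^sup>2 \<le> (norm f)\<^sup>2"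
    unfolding norm_ell2_power2
  proof (rule infsum_mono[OF summable_on_Rep_ell2 summable_on_Rep_ell2])
    show "(norm (Rep_ell2 (Abs_ell2 (\<lambda>x. blinfun_apply (t x) (Rep_ell2 f x))) x))\<^sup>2 \<le> (norm (Rep_ell2 f x))\<^sup>2" for x
      unfolding Rep_Abs by (intro power_mono diag_op_pointwise_le) simp
  qed
  then show ?thesis by simp
qed

private lemma apply_eq: "blinfun_apply (diag_op t) f = Abs_ell2 (\<lambda>x. blinfun_apply (t x) (Rep_ell2 f x))"
proof -
  define T where "T f = Abs_ell2 (\<lambda>x. blinfun_apply (t x) (Rep_ell2 f x))" for f
  have T: "Rep_ell2 (T f) x = blinfun_apply (t x) (Rep_ell2 f x)" "norm (T f) \<le> norm f" for f x
    using norm_le[of f] by (simp_all add: T_def Rep_Abs)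
  have "bounded_linear T"
    by (rule bounded_linear_intro[where K = 1]; (rule ell2_eqI)?)
      (simp_all add: T plus_ell2.rep_eq scaleR_ell2.rep_eq blinfun.add_right blinfun.scaleR_right)
  then show ?thesis by (simp add: diag_op_def bounded_linear_Blinfun_apply flip: T_def)
qed

lemma Rep_ell2_diag_op: "Rep_ell2 (blinfun_apply (diag_op t) f) x = blinfun_apply (t x) (Rep_ell2 f x)"
  by (simp add: apply_eq Rep_Abs)

lemma norm_diag_op_le: "norm (diag_op t) \<le> 1"
  by (rule norm_blinfun_bound) (simp_all add: apply_eq norm_le)

lemma clinear_operators_diag_op:
  "(\<And>x. t x \<in> clinear_operators) \<Longrightarrow> diag_op t \<in> clinear_operators"
  unfolding clinear_operators_def
  by (auto intro!: ell2_eqI simp: Rep_ell2_diag_op scaleC_ell2.rep_eq clinear_operators_def)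

end

definition cutoff :: "'x set \<Rightarrow> ('x, 'h::complex_hilbert_space) ell2 \<Rightarrow>\<^sub>L ('x, 'h) ell2"
  where "cutoff A = diag_op (\<lambda>x. if x \<in> A then id_blinfun else 0)"

lemma norm_id_blinfun_le: "norm (id_blinfun :: 'a::real_normed_vector \<Rightarrow>\<^sub>L 'a) \<le> 1"
  by (rule norm_blinfun_bound) simp_all

lemma norm_cutoff_symbol_le: "norm (if x \<in> A then id_blinfun else 0 :: 'h \<Rightarrow>\<^sub>L 'h::real_normed_vector) \<le> 1"
  by (simp add: norm_id_blinfun_le)

lemma Rep_ell2_cutoff: "Rep_ell2 (blinfun_apply (cutoff A) f) x = (if x \<in> A then Rep_ell2 f x else 0)"
  by (simp add: cutoff_def Rep_ell2_diag_op norm_cutoff_symbol_le)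

lemma norm_cutoff_le: "norm (cutoff A) \<le> 1"
  unfolding cutoff_def by (rule norm_diag_op_le) (rule norm_cutoff_symbol_le)

lemma clinear_operators_cutoff [simp]: "cutoff A \<in> clinear_operators"
  unfolding cutoff_def by (rule clinear_operators_diag_op) (simp_all add: norm_cutoff_symbol_le)

lemma Rep_ell2_sum: "Rep_ell2 (\<Sum>i\<in>I. f i) x = (\<Sum>i\<in>I. Rep_ell2 (f i) x)"
  by (induction I rule: infinite_finite_induct) (simp_all add: plus_ell2.rep_eq zero_ell2.rep_eq)

lemma cutoff_finite:
  assumes "finite F"
  shows "blinfun_apply (cutoff F) f = (\<Sum>x\<in>F. delta_tensor x (Rep_ell2 f x))"
proof (rule ell2_eqI)
  fix y
  have "(\<Sum>x\<in>F. Rep_ell2 (delta_tensor x (Rep_ell2 f x)) y) = (\<Sum>x\<in>F. if y = x then Rep_ell2 f y else 0)"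
    by (rule sum.cong) (auto simp: delta_tensor.rep_eq)
  then show "Rep_ell2 (blinfun_apply (cutoff F) f) y = Rep_ell2 (\<Sum>x\<in>F. delta_tensor x (Rep_ell2 f x)) y"
    using assms by (simp add: Rep_ell2_cutoff Rep_ell2_sum)
qed

lemma tendsto_cutoff: "((\<lambda>F. blinfun_apply (cutoff F) f) \<longlongrightarrow> f) (finite_subsets_at_top UNIV)"
proof -
  let ?g = "\<lambda>x. (norm (Rep_ell2 f x))\<^sup>2"
  have *: "(norm (f - blinfun_apply (cutoff F) f))\<^sup>2 = (norm f)\<^sup>2 - sum ?g F" if "finite F" for F
  proof -
    have "(norm (f - blinfun_apply (cutoff F) f))\<^sup>2 = infsum ?g (UNIV - F)"
      unfolding norm_ell2_power2
      by (rule infsum_cong_neutral) (auto simp: minus_ell2.rep_eq Rep_ell2_cutoff)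
    also have "\<dots> = infsum ?g UNIV - infsum ?g F"
      by (rule infsum_Diff) (simp_all add: summable_on_Rep_ell2)
    finally show ?thesis using that by (simp add: norm_ell2_power2)
  qed
  have "(sum ?g \<longlongrightarrow> (norm f)\<^sup>2) (finite_subsets_at_top UNIV)"
    unfolding norm_ell2_power2 has_sum_def[symmetric] using summable_on_Rep_ell2 by (rule has_sum_infsum)
  then have "((\<lambda>F. sqrt ((norm f)\<^sup>2 - sum ?g F)) \<longlongrightarrow> sqrt ((norm f)\<^sup>2 - (norm f)\<^sup>2)) (finite_subsets_at_top UNIV)"
    by (intro tendsto_intros)
  then have "((\<lambda>F. norm (f - blinfun_apply (cutoff F) f)) \<longlongrightarrow> 0) (finite_subsets_at_top UNIV)"
  proof (rule Lim_transform_eventually[OF _ eventually_finite_subsets_at_top_weakI, THEN tendsto_eq_rhs])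
    fix F :: "'a set" assume "finite F"
    then show "sqrt ((norm f)\<^sup>2 - sum ?g F) = norm (f - blinfun_apply (cutoff F) f)"
      by (simp flip: *)
  qed simp
  then show ?thesis
    by (simp add: tendsto_iff dist_norm norm_minus_commute)
qed

section \<open>Matrix entries\<close>

lemma delta_tensor_scaleC: "delta_tensor x (c *\<^sub>C \<xi>) = c *\<^sub>C delta_tensor x \<xi>"
  by transfer auto

lemma entry_add: "entry (a + b) x y = entry a x y + entry b x y"
  by (rule blinfun_eqI) (simp add: entry_apply blinfun.add_left plus_ell2.rep_eq)

lemma entry_scaleC: "entry (c *\<^sub>C a) x y = c *\<^sub>C entry a x y"
  by (rule blinfun_eqI) (simp add: entry_apply scaleC_blinfun.rep_eq scaleC_ell2.rep_eq)

lemma norm_entry_le: "norm (entry a x y) \<le> norm a"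
proof (rule norm_blinfun_bound)
  show "norm (blinfun_apply (entry a x y) \<xi>) \<le> norm a * norm \<xi>" for \<xi>
    using norm_Rep_ell2_le[of "blinfun_apply a (delta_tensor x \<xi>)" y] norm_blinfun[of a "delta_tensor x \<xi>"]
    by (simp add: entry_apply norm_delta_tensor)
qed simp

lemma clinear_operators_entry: "a \<in> clinear_operators \<Longrightarrow> entry a x y \<in> clinear_operators"
  by (simp add: clinear_operators_def entry_apply delta_tensor_scaleC scaleC_ell2.rep_eq)

lemma cinner_delta_tensor_left: "cinner (delta_tensor y \<eta>) f = cinner \<eta> (Rep_ell2 f y)"
  using cinner_delta_tensor_right[of f y \<eta>] by (metis cinner_commute)

lemma entry_adj:
  assumes "a \<in> clinear_operators"
  shows "entry (adj a) x y = adj (entry a y x)"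
proof (rule adj_eqI[symmetric])
  fix \<xi> \<eta>
  have "cinner (blinfun_apply (entry a y x) \<xi>) \<eta> = cinner (blinfun_apply a (delta_tensor y \<xi>)) (delta_tensor x \<eta>)"
    by (simp add: entry_apply cinner_delta_tensor_right)
  also have "\<dots> = cinner \<xi> (blinfun_apply (entry (adj a) x y) \<eta>)"
    by (simp add: adj_cinner[OF assms] cinner_delta_tensor_left entry_apply)
  finally show "cinner (blinfun_apply (entry a y x) \<xi>) \<eta> = cinner \<xi> (blinfun_apply (entry (adj a) x y) \<eta>)" .
qed

lemma entry_diag_op:
  assumes "\<And>x. norm (t x) \<le> 1"
  shows "entry (diag_op t) x y = (if x = y then t x else 0)"
  by (rule blinfun_eqI) (simp add: entry_apply Rep_ell2_diag_op assms delta_tensor.rep_eq)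

lemma entry_rank_one: "entry (rank_one v w) x y = rank_one (Rep_ell2 v y) (Rep_ell2 w x)"
  by (rule blinfun_eqI) (simp add: entry_apply rank_one_apply scaleC_ell2.rep_eq cinner_delta_tensor_left)

section \<open>Finite propagation\<close>

text \<open>The operators of propagation at most \<open>R\<close>; their union over all \<open>R\<close> is dense in \<open>BD\<close>.\<close>

definition band :: "real \<Rightarrow> (('x::metric_space, 'h::complex_hilbert_space) ell2 \<Rightarrow>\<^sub>L ('x, 'h) ell2) set"
  where "band R = {a \<in> clinear_operators. \<forall>x y. R < dist x y \<longrightarrow> entry a x y = 0}"

lemma bandI:
  assumes "a \<in> clinear_operators"
    and "\<And>x y \<xi>. R < dist x y \<Longrightarrow> Rep_ell2 (blinfun_apply a (delta_tensor x \<xi>)) y = 0"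
  shows "a \<in> band R"
  using assms by (auto simp: band_def entry_apply intro!: blinfun_eqI)

lemma band_clinear: "a \<in> band R \<Longrightarrow> a \<in> clinear_operators"
  by (simp add: band_def)

lemma band_mono: "R \<le> S \<Longrightarrow> band R \<subseteq> band S"
  by (auto simp: band_def)

lemma adj_band: "a \<in> band R \<Longrightarrow> adj a \<in> band R"
  by (auto simp: band_def clinear_operators_adj entry_adj dist_commute intro!: adj_eqI)

lemma add_band: "a \<in> band R \<Longrightarrow> b \<in> band R \<Longrightarrow> a + b \<in> band R"
  by (simp add: band_def clinear_operators_add entry_add)

text \<open>By linearity this is immediate for finitely supported \<open>u\<close>.  To include all vectors, the
  operator is moved to the other side of the inner product, where it acts on a vector supported at
  the single point \<open>x\<close>.\<close>

lemma band_vanishes: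
  assumes b: "b \<in> band R" and u: "\<And>y. dist x y \<le> R \<Longrightarrow> Rep_ell2 u y = 0"
  shows "Rep_ell2 (blinfun_apply b u) x = 0"
proof (rule cinner_ext)
  fix \<eta>
  have "cinner (Rep_ell2 (blinfun_apply b u) x) \<eta> = cinner u (blinfun_apply (adj b) (delta_tensor x \<eta>))"
    by (simp add: adj_cinner[OF band_clinear[OF b], symmetric] cinner_delta_tensor_right)
  also have "\<dots> = (\<Sum>\<^sub>\<infinity>y. cinner (Rep_ell2 u y) (blinfun_apply (entry (adj b) x y) \<eta>))"
    by (simp add: cinner_ell2.rep_eq entry_apply)
  also have "\<dots> = 0"
  proof (rule infsum_0)
    fix y
    show "cinner (Rep_ell2 u y) (blinfun_apply (entry (adj b) x y) \<eta>) = 0"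
      using u[of y] adj_band[OF b] by (cases "dist x y \<le> R") (simp_all add: band_def)
  qed
  finally show "cinner (Rep_ell2 (blinfun_apply b u) x) \<eta> = cinner 0 \<eta>" by simp
qed

lemma compose_band:
  fixes a b :: "('x::metric_space, 'h::complex_hilbert_space) ell2 \<Rightarrow>\<^sub>L ('x, 'h) ell2"
  assumes "a \<in> band R" "b \<in> band S"
  shows "a o\<^sub>L b \<in> band (R + S)"
proof (rule bandI)
  show "a o\<^sub>L b \<in> clinear_operators"
    using assms by (intro clinear_operators_compose band_clinear)
  fix x z :: 'x and \<xi> :: 'h assume "R + S < dist x z"
  then have "Rep_ell2 (blinfun_apply b (delta_tensor x \<xi>)) y = 0" if "dist z y \<le> R" for y
    using that assms(2) dist_triangle2[of x z y] unfolding entry_apply[symmetric]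
    by (simp add: band_def)
  then show "Rep_ell2 (blinfun_apply (a o\<^sub>L b) (delta_tensor x \<xi>)) z = 0"
    using band_vanishes[OF assms(1)] by simp
qed

lemma diag_op_band:
  "(\<And>x. norm (t x) \<le> 1) \<Longrightarrow> (\<And>x. t x \<in> clinear_operators) \<Longrightarrow> diag_op t \<in> band 0"
  by (simp add: band_def clinear_operators_diag_op entry_diag_op)

lemma cutoff_band: "cutoff A \<in> band 0"
  unfolding cutoff_def by (rule diag_op_band) (simp_all add: norm_cutoff_symbol_le)

lemma scaleC_id_band: "c *\<^sub>C id_blinfun \<in> band 0"
  by (rule bandI)
    (auto intro: clinear_operators_scaleC simp: scaleC_blinfun.rep_eq scaleC_ell2.rep_eq delta_tensor.rep_eq)

section \<open>Band-dominated operators\<close>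

lemma propagation_finite_iff:
  "propagation a < \<infinity> \<longleftrightarrow> (\<exists>R. \<forall>x y. R < dist x y \<longrightarrow> entry a x y = 0)"
proof
  assume fin: "propagation a < \<infinity>"
  have "entry a x y = 0" if "enn2real (propagation a) < dist x y" for x y
  proof (rule ccontr)
    assume "entry a x y \<noteq> 0"
    then have "ennreal (dist x y) \<le> propagation a"
      unfolding propagation_def by (intro Sup_upper) blast
    then have "dist x y \<le> enn2real (propagation a)"
      using fin enn2real_mono[of "ennreal (dist x y)" "propagation a"] by (simp add: top.not_eq_extremum)
    with that show False by simp
  qed
  then show "\<exists>R. \<forall>x y. R < dist x y \<longrightarrow> entry a x y = 0" by blast
next
  assume "\<exists>R. \<forall>x y. R < dist x y \<longrightarrow> entry a x y = 0"
  then obtain R where R: "\<And>x y. R < dist x y \<Longrightarrow> entry a x y = 0" by blast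
  have "propagation a \<le> ennreal R"
    unfolding propagation_def using R by (intro Sup_least) (force intro: ennreal_leI leI)
  then show "propagation a < \<infinity>" by (rule le_less_trans) simp
qed

lemma BD_eq: "BD = closure (\<Union>R. band R)"
  unfolding BD_def propagation_finite_iff by (rule arg_cong[where f = closure]) (auto simp: band_def)

lemma BD_iff: "a \<in> BD \<longleftrightarrow> (\<forall>e>0. \<exists>R. \<exists>b\<in>band R. norm (a - b) < e)"
  unfolding BD_eq closure_approachable by (auto simp: dist_norm norm_minus_commute)

lemma band_subset_BD: "band R \<subseteq> BD"
  unfolding BD_eq using closure_subset by fastforce

lemma closed_BD: "closed BD"
  by (simp add: BD_def)

lemma BD_clinear: "a \<in> BD \<Longrightarrow> a \<in> clinear_operators"
proof -
  have "BD \<subseteq> clinear_operators"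
    unfolding BD_def by (rule closure_minimal[OF _ closed_clinear_operators]) auto
  then show "a \<in> BD \<Longrightarrow> a \<in> clinear_operators" by blast
qed

lemma BD_adj:
  assumes "a \<in> BD" shows "adj a \<in> BD"
  unfolding BD_iff
proof (intro allI impI)
  fix e :: real assume "e > 0"
  then obtain R b where b: "b \<in> band R" "norm (a - b) < e"
    using assms BD_iff by blast
  have "norm (adj a - adj b) < e"
    using b norm_adj_le[of "a - b"] BD_clinear[OF assms] band_clinear[OF b(1)]
    by (simp add: adj_diff clinear_operators_diff)
  with adj_band[OF b(1)] show "\<exists>R. \<exists>b\<in>band R. norm (adj a - b) < e" by blast
qed

lemma BD_add:
  assumes "a \<in> BD" "b \<in> BD" shows "a + b \<in> BD"
  unfolding BD_iff
proof (intro allI impI)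
  fix e :: real assume "e > 0"
  then have "e/2 > 0" by simp
  then obtain R a' S b' where ab: "a' \<in> band R" "norm (a - a') < e/2" "b' \<in> band S" "norm (b - b') < e/2"
    using assms unfolding BD_iff by meson
  then have "a' + b' \<in> band (max R S)"
    by (meson add_band band_mono max.cobounded1 max.cobounded2 subsetD)
  moreover have "norm (a + b - (a' + b')) < e"
    using norm_triangle_ineq[of "a - a'" "b - b'"] ab by (simp add: algebra_simps)
  ultimately show "\<exists>R. \<exists>c\<in>band R. norm (a + b - c) < e" by blast
qed

text \<open>Composition is continuous in each factor separately, so it suffices to multiply operators of finite
  propagation: first the left factor is moved to the closure, then the right one.\<close>

lemma BD_compose:
  assumes "a \<in> BD" "b \<in> BD" shows "a o\<^sub>L b \<in> BD"
proof -
  have *: "a o\<^sub>L b \<in> BD" if "a \<in> BD" "b \<in> band S" for a b S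
  proof -
    have "closed ((\<lambda>a. a o\<^sub>L b) -` BD)"
      by (intro closed_vimage closed_BD linear_continuous_on
          bounded_bilinear.bounded_linear_left[OF bounded_bilinear_blinfun_compose])
    moreover have "(\<Union>R. band R) \<subseteq> (\<lambda>a. a o\<^sub>L b) -` BD"
      using compose_band[OF _ that(2)] band_subset_BD by blast
    ultimately have "BD \<subseteq> (\<lambda>a. a o\<^sub>L b) -` BD"
      unfolding BD_eq by (intro closure_minimal) 
    with that(1) show ?thesis by blast
  qed
  have "closed ((\<lambda>b. a o\<^sub>L b) -` BD)"
    by (intro closed_vimage closed_BD linear_continuous_on
        bounded_bilinear.bounded_linear_right[OF bounded_bilinear_blinfun_compose])
  moreover have "(\<Union>R. band R) \<subseteq> (\<lambda>b. a o\<^sub>L b) -` BD"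
    using *[OF assms(1)] by blast
  ultimately have "BD \<subseteq> (\<lambda>b. a o\<^sub>L b) -` BD"
    unfolding BD_eq by (intro closure_minimal)
  with assms(2) show ?thesis by blast
qed

lemma BD_scaleC:
  assumes "a \<in> BD" shows "c *\<^sub>C a \<in> BD"
proof -
  have "c *\<^sub>C a = (c *\<^sub>C id_blinfun) o\<^sub>L a"
    by (rule blinfun_eqI) (simp add: scaleC_blinfun.rep_eq)
  then show ?thesis
    using BD_compose[OF subsetD[OF band_subset_BD scaleC_id_band] assms] by metis
qed

lemma id_BD: "id_blinfun \<in> BD"
  using subsetD[OF band_subset_BD scaleC_id_band[of 1]] by (simp add: scaleC_one)

section \<open>The Roe algebra\<close>

lemma RoeD: "a \<in> Roe \<Longrightarrow> a \<in> BD" "a \<in> Roe \<Longrightarrow> compact_operator (entry a x y)"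
  by (simp_all add: Roe_def)

lemma Roe_clinear: "a \<in> Roe \<Longrightarrow> a \<in> clinear_operators"
  by (simp add: BD_clinear RoeD)

lemma BD_approx: "a \<in> BD \<Longrightarrow> e > 0 \<Longrightarrow> \<exists>R b. b \<in> band R \<and> norm (a - b) < e"
  unfolding BD_iff by blast

lemma Roe_add: "a \<in> Roe \<Longrightarrow> b \<in> Roe \<Longrightarrow> a + b \<in> Roe"
  by (simp add: Roe_def BD_add entry_add compact_operator_add)

lemma Roe_scaleC: "a \<in> Roe \<Longrightarrow> c *\<^sub>C a \<in> Roe"
  by (simp add: Roe_def BD_scaleC entry_scaleC compact_operator_scaleC)

lemma Roe_adj: "a \<in> Roe \<Longrightarrow> adj a \<in> Roe"
  using Roe_clinear[of a]
  by (simp add: Roe_def BD_adj entry_adj compact_operator_adj clinear_operators_entry)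

text \<open>Finiteness of balls makes the matrix product a finite sum, so that it has compact entries as soon as
  the right factor does.\<close>

lemma entry_band_compose:
  fixes a b :: "('x::metric_space, 'h::complex_hilbert_space) ell2 \<Rightarrow>\<^sub>L ('x, 'h) ell2"
  assumes "finite (cball z R)" and b: "b \<in> band R"
  shows "entry (b o\<^sub>L a) x z = (\<Sum>y\<in>cball z R. entry b y z o\<^sub>L entry a x y)"
proof (rule blinfun_eqI)
  fix \<xi>
  define f where "f = blinfun_apply a (delta_tensor x \<xi>)"
  have "Rep_ell2 (blinfun_apply b (f - blinfun_apply (cutoff (cball z R)) f)) z = 0"
    by (rule band_vanishes[OF b]) (simp add: minus_ell2.rep_eq Rep_ell2_cutoff)
  then have "Rep_ell2 (blinfun_apply b f) z = Rep_ell2 (blinfun_apply b (blinfun_apply (cutoff (cball z R)) f)) z"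
    by (simp add: blinfun.diff_right minus_ell2.rep_eq)
  also have "\<dots> = (\<Sum>y\<in>cball z R. blinfun_apply (entry b y z) (Rep_ell2 f y))"
    by (simp add: cutoff_finite[OF assms(1)] blinfun.sum_right Rep_ell2_sum entry_apply)
  finally show "blinfun_apply (entry (b o\<^sub>L a) x z) \<xi> =
      blinfun_apply (\<Sum>y\<in>cball z R. entry b y z o\<^sub>L entry a x y) \<xi>"
    by (simp add: entry_apply blinfun.sum_left f_def)
qed

lemma BD_compose_Roe:
  fixes a m :: "('x::metric_space, 'h::complex_hilbert_space) ell2 \<Rightarrow>\<^sub>L ('x, 'h) ell2"
  assumes lf: "\<And>(x::'x) r. finite (cball x r)" and m: "m \<in> BD" and a: "a \<in> Roe"
  shows "m o\<^sub>L a \<in> Roe"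
proof -
  have "compact_operator (entry (m o\<^sub>L a) x z)" for x z
  proof (rule compact_operator_closed)
    fix e :: real assume e: "e > 0"
    define c where "c = norm a + 1"
    have c: "c > 0" by (simp add: c_def add_nonneg_pos)
    obtain R b where b: "b \<in> band R" "norm (m - b) < e / c"
      using BD_approx[OF m divide_pos_pos[OF e c]] by blast
    have "compact_operator (entry (b o\<^sub>L a) x z)"
      unfolding entry_band_compose[OF lf b(1)]
      by (intro compact_operator_sum compact_operator_compose_left RoeD(2)[OF a])
    moreover have "norm (entry (m o\<^sub>L a) x z - entry (b o\<^sub>L a) x z) < e"
    proof -
      have "entry (m o\<^sub>L a) x z - entry (b o\<^sub>L a) x z = entry ((m - b) o\<^sub>L a) x z"
        by (rule blinfun_eqI) (simp add: entry_apply blinfun.diff_left minus_ell2.rep_eq)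
      then have "norm (entry (m o\<^sub>L a) x z - entry (b o\<^sub>L a) x z) \<le> norm (m - b) * norm a"
        using norm_entry_le[of "(m - b) o\<^sub>L a" x z] norm_blinfun_compose[of "m - b" a] by simp
      also have "\<dots> \<le> norm (m - b) * c" by (intro mult_left_mono) (simp_all add: c_def)
      also have "\<dots> < e" using b(2) c by (simp add: pos_less_divide_eq)
      finally show ?thesis .
    qed
    ultimately show "\<exists>b. compact_operator b \<and> norm (entry (m o\<^sub>L a) x z - b) < e" by blast
  qed
  then show ?thesis using BD_compose[OF m RoeD(1)[OF a]] by (simp add: Roe_def)
qed

lemma Roe_compose_BD:
  fixes a m :: "('x::metric_space, 'h::complex_hilbert_space) ell2 \<Rightarrow>\<^sub>L ('x, 'h) ell2"
  assumes lf: "\<And>(x::'x) r. finite (cball x r)" and m: "m \<in> BD" and a: "a \<in> Roe"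
  shows "a o\<^sub>L m \<in> Roe"
proof -
  have "adj (adj m o\<^sub>L adj a) \<in> Roe"
    by (intro Roe_adj BD_compose_Roe[OF lf] BD_adj m a)
  then show ?thesis
    using Roe_clinear[OF a] BD_clinear[OF m] by (simp add: adj_compose clinear_operators_adj adj_adj)
qed

lemma bounded_bilinear_rank_one:
  "bounded_bilinear (rank_one :: 'a::complex_hilbert_space \<Rightarrow> 'b::complex_hilbert_space \<Rightarrow> _)"
proof
  show "\<exists>K. \<forall>a b. norm (rank_one a b) \<le> norm a * norm b * K"
    by (rule exI[of _ 1]) (simp add: norm_rank_one_le)
qed (rule blinfun_eqI, simp add: rank_one_apply blinfun.add_left blinfun.scaleR_left
    cinner_add_right scaleC_add_left scaleC_add_right scaleR_scaleC[where 'a = 'a]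
    scaleR_scaleC[where 'a = 'b] cinner_scaleC_right scaleC_scaleC mult.commute)+

text \<open>The entries have rank one, and truncating both vectors to a finite set gives approximants of
  finite propagation.\<close>

lemma rank_one_Roe:
  fixes v w :: "('x::metric_space, 'h::complex_hilbert_space) ell2"
  shows "rank_one v w \<in> Roe"
proof -
  let ?r = "\<lambda>F. rank_one (blinfun_apply (cutoff F) v) (blinfun_apply (cutoff F) w)"
  have "?r F \<in> BD" if "finite F" for F
  proof -
    have "?r F \<in> band (diameter F)"
    proof (clarsimp simp: band_def entry_rank_one)
      fix x y :: 'x assume d: "diameter F < dist x y"
      have "\<not> (x \<in> F \<and> y \<in> F)"
        using d diameter_bounded_bound[OF finite_imp_bounded[OF that], of x y] by auto
      then show "rank_one (Rep_ell2 (blinfun_apply (cutoff F) v) y) (Rep_ell2 (blinfun_apply (cutoff F) w) x) = 0"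
        by (intro blinfun_eqI) (auto simp: Rep_ell2_cutoff rank_one_apply)
    qed
    then show ?thesis using band_subset_BD by blast
  qed
  moreover have "(?r \<longlongrightarrow> rank_one v w) (finite_subsets_at_top UNIV)"
    by (rule bounded_bilinear.tendsto[OF bounded_bilinear_rank_one tendsto_cutoff tendsto_cutoff])
  ultimately have "rank_one v w \<in> BD"
    by (rule Lim_in_closed_set[OF closed_BD eventually_finite_subsets_at_top_weakI
          finite_subsets_at_top_neq_bot])
  then show ?thesis by (simp add: Roe_def entry_rank_one compact_operator_rank_one)
qed

text \<open>The block-diagonal projections that test whether a multiplier is in \<open>BD\<close>.\<close>

lemma diag_span_proj:
  fixes S :: "'x::metric_space \<Rightarrow> 'h::complex_hilbert_space set"
  assumes S: "\<And>x. finite (S x)" "\<And>x. orthonormal (S x)"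
  shows diag_span_proj_Roe: "diag_op (\<lambda>x. span_proj (S x)) \<in> Roe"
    and diag_span_proj_band: "diag_op (\<lambda>x. span_proj (S x)) \<in> band 0"
    and norm_diag_span_proj_le: "norm (diag_op (\<lambda>x. span_proj (S x))) \<le> 1"
    and Rep_ell2_diag_span_proj: "Rep_ell2 (blinfun_apply (diag_op (\<lambda>x. span_proj (S x))) f) x =
      blinfun_apply (span_proj (S x)) (Rep_ell2 f x)"
proof -
  have n: "norm (span_proj (S x)) \<le> 1" for x by (rule norm_span_proj_le[OF S(2,1)])
  show b: "diag_op (\<lambda>x. span_proj (S x)) \<in> band 0"
    by (rule diag_op_band) (simp_all add: n)
  then show "diag_op (\<lambda>x. span_proj (S x)) \<in> Roe"
    using band_subset_BD[of 0]
    by (auto simp: Roe_def entry_diag_op n compact_operator_span_proj)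
  show "norm (diag_op (\<lambda>x. span_proj (S x))) \<le> 1"
    by (rule norm_diag_op_le) (rule n)
  show "Rep_ell2 (blinfun_apply (diag_op (\<lambda>x. span_proj (S x))) f) x =
      blinfun_apply (span_proj (S x)) (Rep_ell2 f x)"
    by (rule Rep_ell2_diag_op) (rule n)
qed

lemma norm_contraction_compose_le: "norm p \<le> 1 \<Longrightarrow> norm (p o\<^sub>L a) \<le> norm a"
  by (rule order_trans[OF norm_blinfun_compose]) (simp add: mult_left_le_one_le)

lemma norm_contraction_apply_le: "norm p \<le> 1 \<Longrightarrow> norm (blinfun_apply p v) \<le> norm v"
  by (rule order_trans[OF norm_blinfun]) (simp add: mult_left_le_one_le)

lemma finite_nat_less_real: "finite {n::nat. real n < c}"
proof (rule finite_subset)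
  show "{n::nat. real n < c} \<subseteq> {..nat \<lceil>c\<rceil>}" by (auto, linarith)
qed simp

section \<open>Multipliers of the Roe algebra\<close>

text \<open>If the parts of these rows far away from $x_0$ were not small, there would be vectors $u_n$ vanishing on
  the ball of radius \<open>n\<close> on which they are large.  At each point only finitely many $u_n$ are
  nonzero, so some block-diagonal finite-rank projection \<open>a\<close> fixes all of them.  As $m a$ is in
  \<open>BD\<close>, it is close to an operator of finite propagation, which maps $u_n$ for large \<open>n\<close> to a vector
  vanishing on the given ball; this contradicts $m a u_n = m u_n$.\<close>

lemma multiplier_rows_near_band:
  fixes m :: "('x::metric_space, 'h::complex_hilbert_space) ell2 \<Rightarrow>\<^sub>L ('x, 'h) ell2"
  assumes m: "m \<in> clinear_operators" and mR: "\<And>a. a \<in> Roe \<Longrightarrow> m o\<^sub>L a \<in> BD" and e: "e > 0"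
  shows "\<exists>R. \<exists>b\<in>band R. norm ((cutoff (cball x\<^sub>0 k) o\<^sub>L m) - b) \<le> e"
proof -
  let ?B = "cball x\<^sub>0 k"
  define Q :: "nat \<Rightarrow> ('x, 'h) ell2 \<Rightarrow>\<^sub>L ('x, 'h) ell2" where "Q n = cutoff (- cball x\<^sub>0 (real n))" for n
  have "\<exists>n. norm (cutoff ?B o\<^sub>L m o\<^sub>L Q n) \<le> e"
  proof (rule ccontr)
    assume bad: "\<nexists>n. norm (cutoff ?B o\<^sub>L m o\<^sub>L Q n) \<le> e"
    have "\<exists>v. e * norm v < norm (blinfun_apply (cutoff ?B o\<^sub>L m o\<^sub>L Q n) v)" for n
    proof (rule ccontr)
      assume "\<not> ?thesis"
      then have "norm (cutoff ?B o\<^sub>L m o\<^sub>L Q n) \<le> e"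
        using e by (intro norm_blinfun_bound) (auto simp: not_less)
      with bad show False by blast
    qed
    then obtain v where v: "\<And>n. e * norm (v n) < norm (blinfun_apply (cutoff ?B o\<^sub>L m o\<^sub>L Q n) (v n))"
      by metis
    define u where "u n = blinfun_apply (Q n) (v n)" for n
    have u_le: "norm (u n) \<le> norm (v n)" for n
      unfolding u_def Q_def by (rule norm_contraction_apply_le[OF norm_cutoff_le])
    have u_zero: "Rep_ell2 (u n) y = 0" if "dist x\<^sub>0 y \<le> real n" for n y
      using that by (simp add: u_def Q_def Rep_ell2_cutoff)
    have "\<exists>S. finite S \<and> orthonormal S \<and>
        (\<forall>w\<in>(\<lambda>n. Rep_ell2 (u n) y) ` {n. real n < dist x\<^sub>0 y}. blinfun_apply (span_proj S) w = w)" for y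
      by (rule exists_span_proj_fixing) (simp add: finite_nat_less_real)
    then obtain S where S: "\<And>y. finite (S y)" "\<And>y. orthonormal (S y)"
      "\<And>y n. real n < dist x\<^sub>0 y \<Longrightarrow> blinfun_apply (span_proj (S y)) (Rep_ell2 (u n) y) = Rep_ell2 (u n) y"
      by (metis (no_types, lifting) image_eqI mem_Collect_eq)
    define a where "a = diag_op (\<lambda>y. span_proj (S y))"
    have a: "a \<in> Roe"
      unfolding a_def by (rule diag_span_proj_Roe[OF S(1,2)])
    have au: "blinfun_apply a (u n) = u n" for n
    proof (rule ell2_eqI)
      show "Rep_ell2 (blinfun_apply a (u n)) y = Rep_ell2 (u n) y" for y
        unfolding a_def Rep_ell2_diag_span_proj[OF S(1,2)]
        by (cases "real n < dist x\<^sub>0 y") (simp_all add: S(3) u_zero)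
    qed
    obtain R b where b: "b \<in> band R" "norm ((m o\<^sub>L a) - b) < e"
      using BD_approx[OF mR[OF a] e] by blast
    obtain n :: nat where n: "R + k \<le> real n" using real_arch_simple by blast
    have "blinfun_apply (cutoff ?B) (blinfun_apply b (u n)) = 0"
    proof (rule ell2_eqI)
      fix x
      have "Rep_ell2 (blinfun_apply b (u n)) x = 0" if "x \<in> ?B"
      proof (rule band_vanishes[OF b(1)])
        fix y assume "dist x y \<le> R"
        then show "Rep_ell2 (u n) y = 0"
          using that n dist_triangle[of x\<^sub>0 y x] by (intro u_zero) simp
      qed
      then show "Rep_ell2 (blinfun_apply (cutoff ?B) (blinfun_apply b (u n))) x = Rep_ell2 0 x"
        by (simp add: Rep_ell2_cutoff zero_ell2.rep_eq)
    qed
    then have "blinfun_apply (cutoff ?B o\<^sub>L m o\<^sub>L Q n) (v n) =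
        blinfun_apply (cutoff ?B) (blinfun_apply ((m o\<^sub>L a) - b) (u n))"
      by (simp add: blinfun.diff_left blinfun.diff_right au flip: u_def)
    also have "norm \<dots> \<le> norm (blinfun_apply ((m o\<^sub>L a) - b) (u n))"
      by (rule norm_contraction_apply_le[OF norm_cutoff_le])
    also have "\<dots> \<le> norm ((m o\<^sub>L a) - b) * norm (u n)" by (rule norm_blinfun)
    also have "\<dots> \<le> e * norm (v n)"
      using b(2) u_le[of n] e by (intro mult_mono) auto
    finally show False using v[of n] by simp
  qed
  then obtain n where n: "norm (cutoff ?B o\<^sub>L m o\<^sub>L Q n) \<le> e" by blast
  define b where "b = cutoff ?B o\<^sub>L m o\<^sub>L cutoff (cball x\<^sub>0 (real n))"
  have "b \<in> band (k + real n)"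
  proof (rule bandI)
    show "b \<in> clinear_operators"
      unfolding b_def by (intro clinear_operators_compose m clinear_operators_cutoff)
    fix x y :: 'x and \<xi> :: 'h assume d: "k + real n < dist x y"
    show "Rep_ell2 (blinfun_apply b (delta_tensor x \<xi>)) y = 0"
    proof (cases "x \<in> cball x\<^sub>0 (real n)")
      case True
      then have "y \<notin> ?B" using d dist_triangle3[of x y x\<^sub>0] by auto
      then show ?thesis by (simp add: b_def Rep_ell2_cutoff)
    next
      case False
      then have "blinfun_apply (cutoff (cball x\<^sub>0 (real n))) (delta_tensor x \<xi>) = 0"
        by (intro ell2_eqI) (auto simp: Rep_ell2_cutoff delta_tensor.rep_eq zero_ell2.rep_eq)
      then show ?thesis by (simp add: b_def zero_ell2.rep_eq)
    qed
  qed
  moreover have "(cutoff ?B o\<^sub>L m) - b = cutoff ?B o\<^sub>L m o\<^sub>L Q n"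
  proof (rule blinfun_eqI)
    fix f
    have "f = blinfun_apply (cutoff (cball x\<^sub>0 (real n))) f + blinfun_apply (Q n) f"
      by (rule ell2_eqI) (simp add: Q_def Rep_ell2_cutoff plus_ell2.rep_eq)
    then have "blinfun_apply (cutoff ?B o\<^sub>L m) f =
        blinfun_apply (cutoff ?B o\<^sub>L m) (blinfun_apply (cutoff (cball x\<^sub>0 (real n))) f + blinfun_apply (Q n) f)"
      by simp
    then show "blinfun_apply ((cutoff ?B o\<^sub>L m) - b) f = blinfun_apply (cutoff ?B o\<^sub>L m o\<^sub>L Q n) f"
      by (simp add: b_def blinfun.diff_left blinfun.add_right)
  qed
  ultimately show ?thesis using n by metis
qed

text \<open>Suppose that for every radius \<open>R\<close> some projection is bad.  The rows of \<open>m\<close> over the ball of radius \<open>k\<close>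
  are approximated within propagation $g(k)$ and error $e/2$, so a projection that is bad for $g(k)$ stays bad, with
  error $e/2$, after removing this ball.  The reduced projections are dominated by a single
  block-diagonal finite-rank projection \<open>d\<close>, because at each point only finitely many of them are
  nonzero; but $d m$ is within $e/2$ of an operator of finite propagation.\<close>

lemma multiplier_uniformly_near_band:
  fixes m :: "('x::metric_space, 'h::complex_hilbert_space) ell2 \<Rightarrow>\<^sub>L ('x, 'h) ell2"
  assumes m: "m \<in> clinear_operators" and mR: "\<And>a. a \<in> Roe \<Longrightarrow> m o\<^sub>L a \<in> BD"
    and Rm: "\<And>a. a \<in> Roe \<Longrightarrow> a o\<^sub>L m \<in> BD" and e: "e > 0"
  shows "\<exists>R. \<forall>S. (\<forall>x. finite (S x) \<and> orthonormal (S x)) \<longrightarrow>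
    (\<exists>b\<in>band R. norm ((diag_op (\<lambda>x. span_proj (S x)) o\<^sub>L m) - b) \<le> e)"
proof (rule ccontr)
  assume "\<not> ?thesis"
  then have bad: "\<exists>S. (\<forall>x. finite (S x) \<and> orthonormal (S x)) \<and>
      (\<forall>b\<in>band R. \<not> norm ((diag_op (\<lambda>x. span_proj (S x)) o\<^sub>L m) - b) \<le> e)" for R
    by blast
  fix x\<^sub>0 :: 'x
  have "\<exists>R\<ge>real k. \<exists>b\<in>band R. norm ((cutoff (cball x\<^sub>0 (real k)) o\<^sub>L m) - b) \<le> e/2" for k
  proof -
    obtain R b where "b \<in> band R" "norm ((cutoff (cball x\<^sub>0 (real k)) o\<^sub>L m) - b) \<le> e/2"
      using multiplier_rows_near_band[OF m mR, of "e/2"] e by (metis half_gt_zero)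
    then show ?thesis
      using band_mono[of R "max R (real k)"]
      by (intro exI[of _ "max R (real k)"] conjI bexI[of _ b]) auto
  qed
  then obtain g h where g: "\<And>k. real k \<le> g k" and h: "\<And>k. h k \<in> band (g k)"
      "\<And>k. norm ((cutoff (cball x\<^sub>0 (real k)) o\<^sub>L m) - h k) \<le> e/2"
    by metis
  obtain S where S: "\<And>k x. finite (S k x)" "\<And>k x. orthonormal (S k x)"
      "\<And>k b. b \<in> band (g k) \<Longrightarrow> \<not> norm ((diag_op (\<lambda>x. span_proj (S k x)) o\<^sub>L m) - b) \<le> e"
    using bad[of "g _"] by metis
  \<comment> \<open>Only the projections with index below the distance to the base point survive the removal
    of the balls; \<open>T x\<close> generates a projection that dominates all of these at \<open>x\<close>.\<close>
  have "\<exists>T. finite T \<and> orthonormal T \<and>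
      (\<forall>w\<in>(\<Union>k\<in>{k. real k < dist x\<^sub>0 x}. S k x). blinfun_apply (span_proj T) w = w)" for x
    by (rule exists_span_proj_fixing) (simp add: finite_nat_less_real S(1))
  then obtain T where T: "\<And>x. finite (T x)" "\<And>x. orthonormal (T x)"
      "\<And>x k w. real k < dist x\<^sub>0 x \<Longrightarrow> w \<in> S k x \<Longrightarrow> blinfun_apply (span_proj (T x)) w = w"
    by (metis (no_types, lifting) UN_I mem_Collect_eq)
  define d where "d = diag_op (\<lambda>x. span_proj (T x))"
  have "d \<in> Roe" unfolding d_def by (rule diag_span_proj_Roe[OF T(1,2)])
  obtain R b where b: "b \<in> band R" "norm ((d o\<^sub>L m) - b) < e/2"
    using BD_approx[OF Rm[OF \<open>d \<in> Roe\<close>] half_gt_zero[OF e]] by blast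
  obtain k :: nat where k: "R \<le> real k" using real_arch_simple by blast
  define p where "p = diag_op (\<lambda>x. span_proj (S k x))"
  define Q :: "('x, 'h) ell2 \<Rightarrow>\<^sub>L ('x, 'h) ell2" where "Q = cutoff (- cball x\<^sub>0 (real k))"
  have p: "norm p \<le> 1" "p \<in> band 0"
    unfolding p_def by (rule norm_diag_span_proj_le diag_span_proj_band; rule S(1,2))+
  have pQ: "norm (p o\<^sub>L Q) \<le> 1" "p o\<^sub>L Q \<in> band 0"
    using norm_contraction_compose_le[OF p(1), of Q] norm_cutoff_le compose_band[OF p(2) cutoff_band]
    unfolding Q_def by (auto intro: order_trans)
  \<comment> \<open>Domination is obtained on the left and transferred to the right by taking adjoints.\<close>
  have TS: "span_proj (S k x) o\<^sub>L span_proj (T x) = span_proj (S k x)" if "real k < dist x\<^sub>0 x" for x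
  proof -
    have "span_proj (T x) o\<^sub>L span_proj (S k x) = span_proj (S k x)"
      by (rule compose_span_proj) (simp_all add: T(3)[OF that])
    then have "adj (span_proj (T x) o\<^sub>L span_proj (S k x)) = adj (span_proj (S k x))" by simp
    then show ?thesis by (simp add: adj_compose adj_span_proj)
  qed
  have split: "p o\<^sub>L m = (p o\<^sub>L cutoff (cball x\<^sub>0 (real k)) o\<^sub>L m) + (p o\<^sub>L Q o\<^sub>L d o\<^sub>L m)"
  proof (intro blinfun_eqI ell2_eqI)
    fix f x
    have "blinfun_apply (span_proj (S k x)) (blinfun_apply (span_proj (T x)) w) = blinfun_apply (span_proj (S k x)) w"
      if "real k < dist x\<^sub>0 x" for w
      using TS[OF that] by (metis blinfun_apply_blinfun_compose)
    then show "Rep_ell2 (blinfun_apply (p o\<^sub>L m) f) x =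
        Rep_ell2 (blinfun_apply ((p o\<^sub>L cutoff (cball x\<^sub>0 (real k)) o\<^sub>L m) + (p o\<^sub>L Q o\<^sub>L d o\<^sub>L m)) f) x"
      unfolding p_def d_def Q_def
      by (simp add: blinfun.add_left plus_ell2.rep_eq Rep_ell2_diag_span_proj[OF S(1,2)]
          Rep_ell2_diag_span_proj[OF T(1,2)] Rep_ell2_cutoff not_le)
  qed
  define c where "c = (p o\<^sub>L h k) + (p o\<^sub>L Q o\<^sub>L b)"
  have "c \<in> band (g k)"
  proof -
    have "b \<in> band (g k)"
      using b(1) k g[of k] band_mono[of R "g k"] by auto
    then show ?thesis
      using compose_band[OF p(2) h(1)[of k]] compose_band[OF pQ(2), of b "g k"]
      by (simp add: c_def add_band)
  qed
  moreover have "norm ((p o\<^sub>L m) - c) \<le> e"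
  proof -
    have "(p o\<^sub>L m) - c = (p o\<^sub>L ((cutoff (cball x\<^sub>0 (real k)) o\<^sub>L m) - h k)) + (p o\<^sub>L Q o\<^sub>L ((d o\<^sub>L m) - b))"
      unfolding c_def split
      by (rule blinfun_eqI) (simp add: blinfun.add_left blinfun.diff_left blinfun.diff_right)
    also have "norm \<dots> \<le> norm ((cutoff (cball x\<^sub>0 (real k)) o\<^sub>L m) - h k) + norm ((d o\<^sub>L m) - b)"
      by (intro norm_triangle_mono norm_contraction_compose_le p(1) pQ(1))
    also have "\<dots> \<le> e" using h(2)[of k] b(2) by simp
    finally show ?thesis .
  qed
  ultimately show False using S(3)[of c k] by (simp add: p_def)
qed

text \<open>Finite-rank projections on \<open>H\<close>, repeated along the diagonal, converge strongly to the identity when they are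
  indexed by the finite sets of vectors that they fix.  The uniform propagation bound survives in
  a weak cluster point of the approximants.\<close>

lemma multiplier_of_Roe_in_BD:
  fixes m :: "('x::metric_space, 'h::complex_hilbert_space) ell2 \<Rightarrow>\<^sub>L ('x, 'h) ell2"
  assumes m: "m \<in> clinear_operators" and mR: "\<And>a. a \<in> Roe \<Longrightarrow> m o\<^sub>L a \<in> BD"
    and Rm: "\<And>a. a \<in> Roe \<Longrightarrow> a o\<^sub>L m \<in> BD"
  shows "m \<in> BD"
  unfolding BD_iff
proof (intro allI impI)
  fix e :: real assume "e > 0"
  then have e: "e/2 > 0" by simp
  let ?F = "finite_subsets_at_top (UNIV :: 'h set)"
  obtain R where R: "\<forall>S. (\<forall>x. finite (S x) \<and> orthonormal (S x)) \<longrightarrow>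
      (\<exists>b\<in>band R. norm ((diag_op (\<lambda>x. span_proj (S x)) o\<^sub>L m) - b) \<le> e/2)"
    using multiplier_uniformly_near_band[OF m mR Rm e] by (rule exE)
  \<comment> \<open>The index \<open>V\<close> ranges over all sets, and the bounds needed for a cluster point are required at
    every index; at infinite \<open>V\<close> any finite orthonormal \<open>S V\<close> will do.\<close>
  let ?fixing = "\<lambda>V S. finite S \<and> orthonormal S \<and>
    (finite V \<longrightarrow> (\<forall>w\<in>V. blinfun_apply (span_proj S) w = w))"
  define S where "S V = (SOME S. ?fixing V S)" for V :: "'h set"
  have "\<exists>S. ?fixing V S" for V :: "'h set"
    using exists_span_proj_fixing[of V] by (cases "finite V") (auto intro: exI[of _ "{}"] simp: orthonormal_def)
  then have "?fixing V (S V)" for V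
    unfolding S_def by (rule someI_ex)
  then have S: "finite (S V)" "orthonormal (S V)"
      "finite V \<Longrightarrow> w \<in> V \<Longrightarrow> blinfun_apply (span_proj (S V)) w = w" for V w
    by blast+
  define d :: "'h set \<Rightarrow> ('x, 'h) ell2 \<Rightarrow>\<^sub>L ('x, 'h) ell2"
    where "d V = diag_op (\<lambda>x. span_proj (S V))" for V
  have Rep_d: "Rep_ell2 (blinfun_apply (d V) f) x = blinfun_apply (span_proj (S V)) (Rep_ell2 f x)" for V f x
    unfolding d_def by (rule Rep_ell2_diag_span_proj[OF S(1,2)])
  have norm_d: "norm (d V) \<le> 1" for V
    unfolding d_def by (rule norm_diag_span_proj_le[OF S(1,2)])
  have d_lim: "((\<lambda>V. blinfun_apply (d V) f) \<longlongrightarrow> f) ?F" for f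
  proof (rule tendstoI)
    fix \<epsilon> :: real assume "\<epsilon> > 0"
    then have "\<forall>\<^sub>F F in finite_subsets_at_top UNIV. finite F \<and> dist (blinfun_apply (cutoff F) f) f < \<epsilon>/2"
      by (intro eventually_conj eventually_finite_subsets_at_top_weakI tendstoD[OF tendsto_cutoff]) auto
    then obtain F where F: "finite F" "dist (blinfun_apply (cutoff F) f) f < \<epsilon>/2"
      using eventually_happens'[OF finite_subsets_at_top_neq_bot] by blast
    let ?f = "blinfun_apply (cutoff F) f"
    have "dist (blinfun_apply (d V) f) f < \<epsilon>" if V: "finite V" "Rep_ell2 f ` F \<subseteq> V" for V
    proof -
      have "blinfun_apply (d V) ?f = ?f"
      proof (rule ell2_eqI)
        show "Rep_ell2 (blinfun_apply (d V) ?f) x = Rep_ell2 ?f x" for x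
          using V S(3)[OF V(1), of "Rep_ell2 f x"] by (auto simp: Rep_d Rep_ell2_cutoff)
      qed
      then have "blinfun_apply (d V) f - f = blinfun_apply (d V) (f - ?f) + (?f - f)"
        by (simp add: blinfun.diff_right)
      then have "norm (blinfun_apply (d V) f - f) \<le> norm (f - ?f) + norm (?f - f)"
        by (simp only: norm_triangle_mono[OF norm_contraction_apply_le[OF norm_d] order_refl])
      then show ?thesis using F(2) by (simp add: dist_norm norm_minus_commute)
    qed
    then show "\<forall>\<^sub>F V in ?F. dist (blinfun_apply (d V) f) f < \<epsilon>"
      unfolding eventually_finite_subsets_at_top
      using F(1) by (intro exI[of _ "Rep_ell2 f ` F"]) auto
  qed
  have "\<exists>b\<in>band R. norm ((d V o\<^sub>L m) - b) \<le> e/2" for V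
    unfolding d_def using R[rule_format, of "\<lambda>_. S V"] S(1,2) by simp
  then obtain b where b: "\<And>V. b V \<in> band R" "\<And>V. norm ((d V o\<^sub>L m) - b V) \<le> e/2"
    by metis
  have norm_b: "norm (b V) \<le> norm m + e/2" for V
    using norm_triangle_ineq4[of "d V o\<^sub>L m" "(d V o\<^sub>L m) - b V"] b(2)[of V]
      norm_contraction_compose_le[OF norm_d, of V m] by simp
  have "\<exists>G B. G \<le> ?F \<and> G \<noteq> bot \<and>
      (\<forall>v w. ((\<lambda>V. inner (blinfun_apply (b V) v) w) \<longlongrightarrow> inner (blinfun_apply B v) w) G)"
    by (rule bounded_operators_weak_cluster_point[OF finite_subsets_at_top_neq_bot norm_b])
  then obtain G B where G: "G \<le> ?F" "G \<noteq> bot"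
    and B: "\<And>v w. ((\<lambda>V. inner (blinfun_apply (b V) v) w) \<longlongrightarrow> inner (blinfun_apply B v) w) G"
    by blast
  have "B \<in> band R"
  proof (rule bandI)
    show "B \<in> clinear_operators"
      by (rule weak_limit_clinear_operators[OF G(2) B]) (rule band_clinear[OF b(1)])
    fix x y :: 'x and \<xi> :: 'h assume d: "R < dist x y"
    have coord: "inner (Rep_ell2 f y) \<eta> = inner f (delta_tensor y \<eta>)" for f and \<eta> :: 'h
      by (simp add: inner_eq_Re_cinner cinner_delta_tensor_right)
    have zero: "Rep_ell2 (blinfun_apply (b V) (delta_tensor x \<xi>)) y = 0" for V
      using b(1)[of V] d by (simp add: band_def flip: entry_apply)
    have "inner (Rep_ell2 (blinfun_apply B (delta_tensor x \<xi>)) y) \<eta> = inner 0 \<eta>" for \<eta>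
      using tendsto_unique[OF G(2) B[of "delta_tensor x \<xi>" "delta_tensor y \<eta>"], of 0]
      by (simp add: zero flip: coord)
    then show "Rep_ell2 (blinfun_apply B (delta_tensor x \<xi>)) y = 0" by (rule inner_ext)
  qed
  moreover have "norm (m - B) \<le> e/2"
  proof (rule weak_limit_norm_le[OF G(2)])
    fix v w
    have "((\<lambda>V. inner (blinfun_apply (d V) (blinfun_apply m v)) w - inner (blinfun_apply (b V) v) w)
        \<longlongrightarrow> inner (blinfun_apply m v) w - inner (blinfun_apply B v) w) G"
      by (intro tendsto_diff B tendsto_inner tendsto_const tendsto_mono[OF G(1) d_lim])
    then show "((\<lambda>V. inner (blinfun_apply ((d V o\<^sub>L m) - b V) v) w) \<longlongrightarrow> inner (blinfun_apply (m - B) v) w) G"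
      by (simp add: blinfun.diff_left inner_diff_left)
  qed (rule b(2))
  ultimately show "\<exists>R. \<exists>b\<in>band R. norm (m - b) < e"
    using \<open>e > 0\<close> by (intro exI[of _ R] bexI[of _ B]) auto
qed

section \<open>Spatial implementation of automorphisms\<close>

lemma blinfun_compose_assoc: "(a o\<^sub>L b) o\<^sub>L c = a o\<^sub>L (b o\<^sub>L c)"
  by (rule blinfun_eqI) simp

lemma star_automorphismsD:
  assumes "\<Phi> \<in> star_automorphisms A"
  shows "\<Phi> \<in> extensional A" "bij_betw \<Phi> A A" "a \<in> A \<Longrightarrow> \<Phi> a \<in> A"
    "a \<in> A \<Longrightarrow> b \<in> A \<Longrightarrow> \<Phi> (a + b) = \<Phi> a + \<Phi> b"
    "a \<in> A \<Longrightarrow> \<Phi> (c *\<^sub>C a) = c *\<^sub>C \<Phi> a"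
    "a \<in> A \<Longrightarrow> b \<in> A \<Longrightarrow> \<Phi> (a o\<^sub>L b) = \<Phi> a o\<^sub>L \<Phi> b"
    "a \<in> A \<Longrightarrow> \<Phi> (adj a) = adj (\<Phi> a)"
  using assms by (auto simp: star_automorphisms_def bij_betw_def)

lemma unitaryD:
  assumes "unitary u"
  shows "adj u o\<^sub>L u = id_blinfun" "u o\<^sub>L adj u = id_blinfun"
    "blinfun_apply (adj u) (blinfun_apply u v) = v" "blinfun_apply u (blinfun_apply (adj u) v) = v"
proof -
  show *: "adj u o\<^sub>L u = id_blinfun" "u o\<^sub>L adj u = id_blinfun"
    using assms by (simp_all add: unitary_def)
  show "blinfun_apply (adj u) (blinfun_apply u v) = v" "blinfun_apply u (blinfun_apply (adj u) v) = v"
    using *[THEN arg_cong[where f = "\<lambda>b. blinfun_apply b v"]] by simp_all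
qed

text \<open>The reason is that rank-one projections are characterised algebraically as the nonzero projections
  with one-dimensional corner; see the introduction of this theory for the formula of the unitary.\<close>

lemma star_automorphism_spatial:
  fixes A :: "('a::complex_hilbert_space \<Rightarrow>\<^sub>L 'a) set"
  assumes lin: "A \<subseteq> clinear_operators" and rank_one: "\<And>v w. rank_one v w \<in> A"
    and \<Phi>: "\<Phi> \<in> star_automorphisms A" and nontrivial: "\<exists>v::'a. v \<noteq> 0"
  shows "\<exists>u\<in>clinear_operators. unitary u \<and> (\<forall>a\<in>A. \<Phi> a = u o\<^sub>L a o\<^sub>L adj u)"
proof -
  note [simp] = rank_one
  note \<Phi> = star_automorphismsD[OF \<Phi>]
  have lin: "a \<in> A \<Longrightarrow> a \<in> clinear_operators" for a using lin by blast
  have unit: "\<exists>v'. cinner v' v' = 1 \<and> (\<exists>c. v' = c *\<^sub>C v)" if "v \<noteq> 0" for v :: 'a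
  proof (intro exI[of _ "complex_of_real (inverse (norm v)) *\<^sub>C v"] conjI exI)
    show "cinner (complex_of_real (inverse (norm v)) *\<^sub>C v) (complex_of_real (inverse (norm v)) *\<^sub>C v) = 1"
      using that by (simp add: cinner_self norm_scaleC del: of_real_inverse)
  qed (rule refl)
  obtain e :: 'a where e: "cinner e e = 1"
    using nontrivial unit by blast
  define p where "p = rank_one e e"
  define q where "q = \<Phi> p"
  have pA: "p \<in> A" by (simp add: p_def)
  have pp: "p o\<^sub>L p = p"
    by (simp add: p_def rank_one_compose_rank_one e scaleC_one)
  have qA: "q \<in> A" using \<Phi>(3)[OF pA] by (simp add: q_def)
  have qq: "q o\<^sub>L q = q" using \<Phi>(6)[OF pA pA] by (simp add: pp q_def)
  have q_adj: "adj q = q" using \<Phi>(7)[OF pA] by (simp add: q_def p_def adj_rank_one)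
  \<comment> \<open>The corner of \<open>q\<close> is the image of the corner of \<open>p\<close>, hence one-dimensional.\<close>
  have corner: "\<exists>c. q o\<^sub>L a o\<^sub>L q = c *\<^sub>C q" if "a \<in> A" for a
  proof -
    obtain b where b: "b \<in> A" "a = \<Phi> b"
      using \<Phi>(2) \<open>a \<in> A\<close> by (auto simp: bij_betw_def)
    have bp: "b o\<^sub>L p = rank_one (blinfun_apply b e) e"
      by (simp add: p_def compose_rank_one lin b(1))
    have "p o\<^sub>L (b o\<^sub>L p) = cinner (blinfun_apply b e) e *\<^sub>C p"
      unfolding bp by (simp add: p_def rank_one_compose_rank_one)
    moreover have "\<Phi> (p o\<^sub>L (b o\<^sub>L p)) = q o\<^sub>L (a o\<^sub>L q)"
      using \<Phi>(6)[OF pA, of "b o\<^sub>L p"] \<Phi>(6)[OF b(1) pA] by (simp add: bp b(2) q_def)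
    ultimately have "q o\<^sub>L (a o\<^sub>L q) = cinner (blinfun_apply b e) e *\<^sub>C q"
      using \<Phi>(5)[OF pA] by (simp add: q_def)
    then show ?thesis unfolding blinfun_compose_assoc by blast
  qed
  have "q \<noteq> 0"
  proof
    assume "q = 0"
    have "0 *\<^sub>C p = 0" by (rule blinfun_eqI) (simp add: scaleC_blinfun.rep_eq)
    moreover have "0 *\<^sub>C q = 0" by (rule blinfun_eqI) (simp add: scaleC_blinfun.rep_eq)
    moreover have "0 *\<^sub>C p = rank_one 0 e" by (rule blinfun_eqI) (simp add: scaleC_blinfun.rep_eq rank_one_apply)
    ultimately have z: "\<Phi> 0 = 0" "0 \<in> A"
      using \<Phi>(5)[OF pA, of 0] rank_one[of 0 e] by (simp_all add: q_def)
    then have "p = 0"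
      using \<open>q = 0\<close> \<Phi>(2) pA by (auto simp: q_def bij_betw_def inj_on_def)
    then have "blinfun_apply p e = 0" by simp
    then show False using e by (simp add: p_def rank_one_apply scaleC_one)
  qed
  then obtain w where "blinfun_apply q w \<noteq> 0"
    using blinfun_eqI[of q 0] by auto
  then obtain f c where f: "cinner f f = 1" "f = c *\<^sub>C blinfun_apply q w"
    using unit by blast
  have "blinfun_apply q (blinfun_apply q w) = blinfun_apply q w"
    by (metis qq blinfun_apply_blinfun_compose)
  then have qf: "blinfun_apply q f = f"
    by (simp add: f(2) clinear_operatorsD[OF lin[OF qA]])
  have q_eq: "q = rank_one f f"
  proof -
    have l: "q o\<^sub>L rank_one f f = rank_one f f"
      by (simp add: compose_rank_one lin qA qf)
    then have "adj (q o\<^sub>L rank_one f f) = adj (rank_one f f)" by simp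
    then have "rank_one f f o\<^sub>L q = rank_one f f"
      by (simp add: adj_compose lin qA q_adj adj_rank_one)
    then obtain d where d: "rank_one f f = d *\<^sub>C q"
      using corner[OF rank_one[of f f]] l by auto
    have "blinfun_apply (rank_one f f) f = d *\<^sub>C f"
      by (simp add: d scaleC_blinfun.rep_eq qf)
    then have "f = d *\<^sub>C f" by (simp add: rank_one_apply f(1) scaleC_one)
    then have "cinner f f = cinner (d *\<^sub>C f) f" by simp
    then have "d = 1" by (simp add: cinner_scaleC_left f(1))
    then show ?thesis using d by (simp add: scaleC_one)
  qed
  \<comment> \<open>Since \<open>v \<otimes> e*\<close> has initial projection \<open>p\<close>, its image has initial projection \<open>q\<close> and may be
    evaluated at \<open>f\<close> without loss.\<close>
  define V where "V v = blinfun_apply (\<Phi> (rank_one v e)) f" for v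
  have V_add: "V (v + w) = V v + V w" for v w
    by (simp add: V_def rank_one_add_left \<Phi>(4) blinfun.add_left)
  have V_scaleC: "V (c *\<^sub>C v) = c *\<^sub>C V v" for c v
    by (simp add: V_def rank_one_scaleC_left \<Phi>(5) scaleC_blinfun.rep_eq)
  have V_cinner: "cinner (V v) (V w) = cinner v w" for v w
  proof -
    have "adj (\<Phi> (rank_one w e)) = \<Phi> (rank_one e w)"
      using \<Phi>(7)[of "rank_one w e"] by (simp add: adj_rank_one)
    then have "cinner (V v) (V w) = cinner (blinfun_apply (\<Phi> (rank_one e w) o\<^sub>L \<Phi> (rank_one v e)) f) f"
      using adj_cinner'[OF lin[OF \<Phi>(3)[OF rank_one[of w e]]], of "V v" f] by (simp add: V_def)
    also have "\<Phi> (rank_one e w) o\<^sub>L \<Phi> (rank_one v e) = cinner v w *\<^sub>C q"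
      using \<Phi>(6)[of "rank_one e w" "rank_one v e"] \<Phi>(5)[OF pA]
      by (simp add: rank_one_compose_rank_one q_def p_def)
    also have "cinner (blinfun_apply (cinner v w *\<^sub>C q) f) f = cinner v w"
      by (simp add: scaleC_blinfun.rep_eq qf cinner_scaleC_left f(1))
    finally show ?thesis .
  qed
  have "norm (V v) = norm v" for v
    using V_cinner[of v v] by (simp add: cinner_self flip: of_real_power)
  then have V_bl: "bounded_linear V"
    by (intro bounded_linear_intro[where K = 1]) (simp_all add: V_add scaleR_scaleC V_scaleC)
  define u where "u = Blinfun V"
  have u: "blinfun_apply u v = V v" for v
    by (simp add: u_def bounded_linear_Blinfun_apply[OF V_bl])
  have u_lin: "u \<in> clinear_operators"
    by (simp add: clinear_operators_def u V_scaleC)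
  have surj: "\<exists>v. V v = h" for h
  proof -
    have "rank_one h f \<in> \<Phi> ` A"
      using bij_betw_imp_surj_on[OF \<Phi>(2)] by simp
    then obtain b where b: "b \<in> A" "rank_one h f = \<Phi> b" by blast
    have "h = blinfun_apply (rank_one h f) f" by (simp add: rank_one_apply f(1) scaleC_one)
    also have "\<dots> = blinfun_apply (\<Phi> b o\<^sub>L q) f" by (simp add: b(2) qf)
    also have "\<Phi> b o\<^sub>L q = \<Phi> (rank_one (blinfun_apply b e) e)"
      using \<Phi>(6)[OF b(1) pA] by (simp add: q_def p_def compose_rank_one lin b(1))
    finally show ?thesis unfolding V_def by metis
  qed
  have "adj u o\<^sub>L u = id_blinfun"
    by (intro blinfun_eqI cinner_ext) (simp add: adj_cinner'[OF u_lin] u V_cinner)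
  then have adj_u: "blinfun_apply (adj u) (V v) = v" for v
    by (metis blinfun_apply_blinfun_compose id_blinfun.rep_eq id_apply u)
  have "u o\<^sub>L adj u = id_blinfun"
  proof (rule blinfun_eqI)
    fix h
    obtain v where "V v = h" using surj by blast
    then show "blinfun_apply (u o\<^sub>L adj u) h = blinfun_apply id_blinfun h"
      using adj_u[of v] by (simp add: u)
  qed
  with \<open>adj u o\<^sub>L u = id_blinfun\<close> have "unitary u" by (simp add: unitary_def)
  moreover have "\<Phi> a = u o\<^sub>L a o\<^sub>L adj u" if "a \<in> A" for a
  proof (rule blinfun_eqI)
    fix h
    obtain v where v: "V v = h" using surj by blast
    have "blinfun_apply (\<Phi> a) (V v) = blinfun_apply (\<Phi> (a o\<^sub>L rank_one v e)) f"
      using \<Phi>(6)[OF that rank_one] by (simp add: V_def)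
    also have "\<dots> = V (blinfun_apply a v)"
      by (simp add: V_def compose_rank_one lin that)
    finally show "blinfun_apply (\<Phi> a) h = blinfun_apply (u o\<^sub>L a o\<^sub>L adj u) h"
      using adj_u[of v] by (simp add: u v)
  qed
  ultimately show ?thesis using u_lin by blast
qed

section \<open>Automorphism groups\<close>

definition star_subalgebra :: "('a::complex_hilbert_space \<Rightarrow>\<^sub>L 'a) set \<Rightarrow> bool"
  where "star_subalgebra A \<longleftrightarrow> A \<subseteq> clinear_operators \<and>
    (\<forall>a\<in>A. \<forall>b\<in>A. a + b \<in> A \<and> a o\<^sub>L b \<in> A) \<and> (\<forall>a\<in>A. adj a \<in> A \<and> (\<forall>c. c *\<^sub>C a \<in> A))"

lemma star_subalgebraD:
  assumes "star_subalgebra A"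
  shows "a \<in> A \<Longrightarrow> a \<in> clinear_operators" "a \<in> A \<Longrightarrow> b \<in> A \<Longrightarrow> a + b \<in> A"
    "a \<in> A \<Longrightarrow> b \<in> A \<Longrightarrow> a o\<^sub>L b \<in> A" "a \<in> A \<Longrightarrow> adj a \<in> A" "a \<in> A \<Longrightarrow> c *\<^sub>C a \<in> A"
  using assms by (auto simp: star_subalgebra_def)

lemma group_Aut:
  assumes "star_subalgebra A" shows "group (Aut A)"
proof (rule groupI)
  note A = star_subalgebraD[OF assms]
  fix \<Phi> assume "\<Phi> \<in> carrier (Aut A)"
  then have \<Phi>: "\<Phi> \<in> star_automorphisms A" by (simp add: Aut_def)
  note \<Phi>D = star_automorphismsD[OF \<Phi>]
  show "\<one>\<^bsub>Aut A\<^esub> \<otimes>\<^bsub>Aut A\<^esub> \<Phi> = \<Phi>"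
    using \<Phi>D(1,3) by (auto simp: Aut_def compose_def extensional_def)
  fix \<Psi> assume "\<Psi> \<in> carrier (Aut A)"
  then have \<Psi>: "\<Psi> \<in> star_automorphisms A" by (simp add: Aut_def)
  note \<Psi>D = star_automorphismsD[OF \<Psi>]
  have "bij_betw (compose A \<Phi> \<Psi>) A A"
    using bij_betw_trans[OF \<Psi>D(2) \<Phi>D(2)] by (simp add: bij_betw_def compose_def inj_on_def image_comp)
  then show "\<Phi> \<otimes>\<^bsub>Aut A\<^esub> \<Psi> \<in> carrier (Aut A)"
    by (simp add: Aut_def star_automorphisms_def compose_def A \<Phi>D \<Psi>D)
  fix \<Theta> assume "\<Theta> \<in> carrier (Aut A)"
  then have "\<Theta> \<in> A \<rightarrow> A" by (simp add: Aut_def star_automorphismsD)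
  then show "\<Phi> \<otimes>\<^bsub>Aut A\<^esub> \<Psi> \<otimes>\<^bsub>Aut A\<^esub> \<Theta> = \<Phi> \<otimes>\<^bsub>Aut A\<^esub> (\<Psi> \<otimes>\<^bsub>Aut A\<^esub> \<Theta>)"
    by (simp add: Aut_def compose_assoc)
next
  note A = star_subalgebraD[OF assms]
  show "\<one>\<^bsub>Aut A\<^esub> \<in> carrier (Aut A)"
    by (simp add: Aut_def star_automorphisms_def A bij_betw_def inj_on_def)
  fix \<Phi> assume "\<Phi> \<in> carrier (Aut A)"
  then have \<Phi>: "\<Phi> \<in> star_automorphisms A" by (simp add: Aut_def)
  note \<Phi>D = star_automorphismsD[OF \<Phi>]
  define \<Psi> where "\<Psi> = restrict (inv_into A \<Phi>) A"
  have inj: "inj_on \<Phi> A" and surj: "\<Phi> ` A = A" using \<Phi>D(2) by (simp_all add: bij_betw_def)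
  have \<Psi>: "\<Psi> a \<in> A" "\<Phi> (\<Psi> a) = a" if "a \<in> A" for a
    using that surj by (simp_all add: \<Psi>_def inv_into_into f_inv_into_f)
  have eqI: "\<Psi> a = b" if "a \<in> A" "b \<in> A" "a = \<Phi> b" for a b
    using that inj \<Psi> by (metis inj_onD)
  have "\<Psi> \<in> star_automorphisms A"
    unfolding star_automorphisms_def
  proof (intro CollectI conjI ballI allI)
    show "\<Psi> \<in> extensional A" by (simp add: \<Psi>_def)
    show "bij_betw \<Psi> A A"
      using bij_betw_inv_into[OF \<Phi>D(2)] by (simp add: \<Psi>_def bij_betw_def inj_on_def image_def)
  qed (rule eqI; simp add: A \<Psi> \<Phi>D)+
  moreover have "\<Psi> \<otimes>\<^bsub>Aut A\<^esub> \<Phi> = \<one>\<^bsub>Aut A\<^esub>"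
    by (auto simp: Aut_def compose_def fun_eq_iff intro: eqI \<Phi>D(3))
  ultimately show "\<exists>\<Psi>\<in>carrier (Aut A). \<Psi> \<otimes>\<^bsub>Aut A\<^esub> \<Phi> = \<one>\<^bsub>Aut A\<^esub>"
    by (auto simp: Aut_def)
qed

definition Ad :: "('a::complex_hilbert_space \<Rightarrow>\<^sub>L 'a) \<Rightarrow> ('a \<Rightarrow>\<^sub>L 'a) \<Rightarrow> ('a \<Rightarrow>\<^sub>L 'a)"
  where "Ad u a = u o\<^sub>L a o\<^sub>L adj u"

lemma unitary_adj: "u \<in> clinear_operators \<Longrightarrow> unitary u \<Longrightarrow> unitary (adj u)"
  by (simp add: unitary_def adj_adj)

lemma Ad_Ad_adj:
  assumes "u \<in> clinear_operators" "unitary u"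
  shows "Ad u (Ad (adj u) a) = a" "Ad (adj u) (Ad u a) = a"
  by (rule blinfun_eqI, simp add: Ad_def adj_adj assms(1) unitaryD[OF assms(2)])+

lemma Ad_compose:
  assumes "unitary u" shows "Ad u (a o\<^sub>L b) = Ad u a o\<^sub>L Ad u b"
  by (rule blinfun_eqI) (simp add: Ad_def unitaryD[OF assms])

lemma Ad_of_compose:
  "u \<in> clinear_operators \<Longrightarrow> v \<in> clinear_operators \<Longrightarrow> Ad (u o\<^sub>L v) a = Ad u (Ad v a)"
  by (rule blinfun_eqI) (simp add: Ad_def adj_compose)

lemma Ad_clinear: "u \<in> clinear_operators \<Longrightarrow> a \<in> clinear_operators \<Longrightarrow> Ad u a \<in> clinear_operators"
  by (simp add: Ad_def clinear_operators_compose clinear_operators_adj)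

lemma Ad_star_automorphism:
  assumes A: "star_subalgebra A" and u: "u \<in> clinear_operators" "unitary u"
    and Ad: "\<And>a. a \<in> A \<Longrightarrow> Ad u a \<in> A" "\<And>a. a \<in> A \<Longrightarrow> Ad (adj u) a \<in> A"
  shows "restrict (Ad u) A \<in> star_automorphisms A"
  unfolding star_automorphisms_def
proof (intro CollectI conjI ballI allI)
  note A = star_subalgebraD[OF A]
  show "bij_betw (restrict (Ad u) A) A A"
    by (rule bij_betwI[of _ _ _ "Ad (adj u)"]) (simp_all add: Ad Ad_Ad_adj u)
  show "restrict (Ad u) A (a + b) = restrict (Ad u) A a + restrict (Ad u) A b" if "a \<in> A" "b \<in> A" for a b
    using that A by (simp add: Ad_def blinfun_eqI blinfun.add_left blinfun.add_right)
  show "restrict (Ad u) A (c *\<^sub>C a) = c *\<^sub>C restrict (Ad u) A a" if "a \<in> A" for c a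
    using that A u by (simp add: Ad_def blinfun_compose_scaleC)
  show "restrict (Ad u) A (a o\<^sub>L b) = restrict (Ad u) A a o\<^sub>L restrict (Ad u) A b" if "a \<in> A" "b \<in> A" for a b
    using that A by (simp add: Ad_compose u)
  show "restrict (Ad u) A (adj a) = adj (restrict (Ad u) A a)" if "a \<in> A" for a
    using that A(1)[OF that] A(4)[OF that] u
    by (simp add: Ad_def adj_compose adj_adj clinear_operators_compose clinear_operators_adj blinfun_compose_assoc)
qed simp

lemma star_subalgebra_BD: "star_subalgebra BD"
  by (auto simp: star_subalgebra_def BD_clinear BD_add BD_compose BD_adj BD_scaleC)

lemma star_subalgebra_Roe:
  assumes "\<And>(x::'x::metric_space) r. finite (cball x r)"
  shows "star_subalgebra (Roe :: (('x, 'h::complex_hilbert_space) ell2 \<Rightarrow>\<^sub>L ('x, 'h) ell2) set)"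
  by (auto simp: star_subalgebra_def Roe_clinear Roe_add Roe_adj Roe_scaleC
      intro: BD_compose_Roe[OF assms RoeD(1)])

text \<open>The multiplier description of \<open>BD\<close> is preserved by any unitary that normalises the Roe algebra:
  $(u m u^*) a = u (m (u^* a u)) u^*$.\<close>

lemma Ad_BD:
  fixes u :: "('x::metric_space, 'h::complex_hilbert_space) ell2 \<Rightarrow>\<^sub>L ('x, 'h) ell2"
  assumes lf: "\<And>(x::'x) r. finite (cball x r)" and u: "u \<in> clinear_operators" "unitary u"
    and Ad: "\<And>a. a \<in> Roe \<Longrightarrow> Ad u a \<in> Roe" "\<And>a. a \<in> Roe \<Longrightarrow> Ad (adj u) a \<in> Roe"
    and m: "m \<in> BD"
  shows "Ad u m \<in> BD"
proof (rule multiplier_of_Roe_in_BD)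
  show "Ad u m \<in> clinear_operators" by (intro Ad_clinear u BD_clinear m)
  fix a :: "('x, 'h) ell2 \<Rightarrow>\<^sub>L ('x, 'h) ell2" assume a: "a \<in> Roe"
  have "Ad u m o\<^sub>L a = Ad u (m o\<^sub>L Ad (adj u) a)"
    by (simp add: Ad_compose u Ad_Ad_adj)
  also have "\<dots> \<in> Roe" by (intro Ad BD_compose_Roe[OF lf] m a)
  finally show "Ad u m o\<^sub>L a \<in> BD" by (rule RoeD)
  have "a o\<^sub>L Ad u m = Ad u (Ad (adj u) a o\<^sub>L m)"
    by (simp add: Ad_compose u Ad_Ad_adj)
  also have "\<dots> \<in> Roe" by (intro Ad Roe_compose_BD[OF lf] m a)
  finally show "a o\<^sub>L Ad u m \<in> BD" by (rule RoeD)
qed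

theorem corollary4p3:
  assumes "uniformly_locally_finite (UNIV :: 'x::metric_space set)"
    and "separable_space (euclidean :: 'h::complex_hilbert_space topology)"
    and "\<not> (\<exists>B :: 'h set. finite B \<and> module.span scaleC B = UNIV)"
  shows "(\<forall>\<Phi> \<in> carrier (Aut (Roe :: (('x, 'h) ell2 \<Rightarrow>\<^sub>L ('x, 'h) ell2) set)).
            \<exists>\<Psi> \<in> carrier (Aut BD). \<forall>a\<in>Roe. \<Psi> a = \<Phi> a) \<and>
         (\<lambda>\<phi>. restrict \<phi> Roe) ` Inn BD \<lhd> Aut (Roe :: (('x, 'h) ell2 \<Rightarrow>\<^sub>L ('x, 'h) ell2) set)"
proof -
  let ?Roe = "Roe :: (('x, 'h) ell2 \<Rightarrow>\<^sub>L ('x, 'h) ell2) set"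
  let ?N = "(\<lambda>\<phi>. restrict \<phi> ?Roe) ` Inn BD"
  \<comment> \<open>The definition only speaks of positive radii.\<close>
  have lf: "finite (cball x r)" for x :: 'x and r
  proof (rule finite_subset)
    show "cball x r \<subseteq> UNIV \<inter> cball x (max r 1)" by auto
    have "max r 1 > 0" by simp
    then show "finite (UNIV \<inter> cball x (max r 1))"
      using assms(1) unfolding uniformly_locally_finite_def by blast
  qed
  note Roe_alg = star_subalgebra_Roe[OF lf, where 'h = 'h]
  interpret group "Aut ?Roe" by (rule group_Aut[OF Roe_alg])
  have "\<exists>\<xi>::'h. \<xi> \<noteq> 0"
  proof (rule ccontr)
    assume "\<not> ?thesis"
    moreover have "module (scaleC :: complex \<Rightarrow> 'h \<Rightarrow> 'h)"
      by unfold_locales (simp_all add: scaleC_add_right scaleC_add_left scaleC_scaleC scaleC_one)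
    ultimately have "module.span scaleC {} = (UNIV :: 'h set)"
      by (auto simp: module.span_empty)
    then show False using assms(3) by blast
  qed
  then obtain \<xi> :: 'h where "\<xi> \<noteq> 0" by blast
  then have nontrivial: "\<exists>v::('x, 'h) ell2. v \<noteq> 0"
    by (intro exI[of _ "delta_tensor undefined \<xi>"]) (metis norm_delta_tensor norm_eq_zero)
  have spatial: "\<exists>u\<in>clinear_operators. unitary u \<and> (\<forall>a\<in>Roe. \<Phi> a = Ad u a) \<and>
      (\<forall>a\<in>?Roe. Ad u a \<in> Roe \<and> Ad (adj u) a \<in> Roe) \<and> (\<forall>m\<in>BD. Ad u m \<in> BD \<and> Ad (adj u) m \<in> BD)"
    if \<Phi>: "\<Phi> \<in> star_automorphisms Roe" for \<Phi>
  proof -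
    obtain u where u: "u \<in> clinear_operators" "unitary u" and \<Phi>_eq: "\<And>a. a \<in> Roe \<Longrightarrow> \<Phi> a = Ad u a"
      using star_automorphism_spatial[OF _ rank_one_Roe \<Phi> nontrivial] Roe_clinear
      unfolding Ad_def by blast
    have Ad_u: "Ad u a \<in> Roe" if "a \<in> Roe" for a
      using star_automorphismsD(3)[OF \<Phi> that] \<Phi>_eq[OF that] by simp
    have Ad_adj: "Ad (adj u) a \<in> Roe" if "a \<in> Roe" for a
    proof -
      have "a \<in> \<Phi> ` Roe"
        using bij_betw_imp_surj_on[OF star_automorphismsD(2)[OF \<Phi>]] that by simp
      then obtain b where "b \<in> Roe" "a = \<Phi> b" by blast
      then show ?thesis by (simp add: \<Phi>_eq Ad_Ad_adj u)
    qed
    have "Ad u m \<in> BD" if "m \<in> BD" for m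
      by (rule Ad_BD[OF lf u Ad_u Ad_adj that])
    moreover have "Ad (adj u) m \<in> BD" if "m \<in> BD" for m
      by (rule Ad_BD[OF lf clinear_operators_adj[OF u(1)] unitary_adj[OF u] Ad_adj _ that])
        (simp_all only: adj_adj[OF u(1)] Ad_u)
    ultimately show ?thesis using u \<Phi>_eq Ad_u Ad_adj by blast
  qed
  have extension: "\<exists>\<Psi>\<in>carrier (Aut BD). \<forall>a\<in>Roe. \<Psi> a = \<Phi> a" if "\<Phi> \<in> carrier (Aut ?Roe)" for \<Phi>
  proof -
    have "\<Phi> \<in> star_automorphisms Roe" using that by (simp add: Aut_def)
    from spatial[OF this] obtain u where u: "u \<in> clinear_operators" "unitary u"
        "\<And>a. a \<in> Roe \<Longrightarrow> \<Phi> a = Ad u a"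
        "\<And>m. m \<in> BD \<Longrightarrow> Ad u m \<in> BD" "\<And>m. m \<in> BD \<Longrightarrow> Ad (adj u) m \<in> BD"
      by blast
    show ?thesis
    proof (intro bexI ballI)
      show "restrict (Ad u) BD \<in> carrier (Aut BD)"
        using Ad_star_automorphism[OF star_subalgebra_BD u(1,2,4,5)] by (simp add: Aut_def)
      show "restrict (Ad u) BD a = \<Phi> a" if "a \<in> Roe" for a
        by (simp add: u(3)[OF that] RoeD(1)[OF that])
    qed
  qed
  have Ad_Roe: "Ad u a \<in> Roe" if "u \<in> BD" "a \<in> ?Roe" for u a
    unfolding Ad_def using that by (intro Roe_compose_BD[OF lf] BD_compose_Roe[OF lf] BD_adj)
  have N_eq: "?N = {restrict (Ad u) Roe | u. u \<in> BD \<and> unitary u}"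
  proof -
    have "restrict (\<lambda>a\<in>BD. u o\<^sub>L a o\<^sub>L adj u) ?Roe = restrict (Ad u) Roe" for u
      by (rule restrict_ext) (simp add: Ad_def RoeD(1))
    then show ?thesis unfolding Inn_def setcompr_eq_image image_image by (simp only:)
  qed
  have N_mult: "restrict (Ad u) Roe \<otimes>\<^bsub>Aut ?Roe\<^esub> restrict (Ad v) Roe = restrict (Ad (u o\<^sub>L v)) Roe"
    if "u \<in> clinear_operators" "v \<in> BD" for u v
  proof -
    have "compose ?Roe (restrict (Ad u) Roe) (restrict (Ad v) Roe) a = restrict (Ad (u o\<^sub>L v)) Roe a" for a
      by (cases "a \<in> ?Roe") (simp_all add: compose_def Ad_Roe that Ad_of_compose BD_clinear)
    then show ?thesis by (auto simp: Aut_def)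
  qed
  have N_carrier: "restrict (Ad u) ?Roe \<in> carrier (Aut ?Roe)" if "u \<in> BD" "unitary u" for u
    using Ad_star_automorphism[OF Roe_alg BD_clinear[OF that(1)] that(2)
        Ad_Roe[OF that(1)] Ad_Roe[OF BD_adj[OF that(1)]]]
    by (simp add: Aut_def)
  have unitary_compose: "unitary (u o\<^sub>L v)"
    if "u \<in> clinear_operators" "v \<in> clinear_operators" "unitary u" "unitary v"
    for u v :: "('x, 'h) ell2 \<Rightarrow>\<^sub>L ('x, 'h) ell2"
    unfolding unitary_def adj_compose[OF that(1,2)]
    by (intro conjI; rule blinfun_eqI; simp add: unitaryD[OF that(3)] unitaryD[OF that(4)])
  have one: "restrict (Ad id_blinfun) Roe = \<one>\<^bsub>Aut ?Roe\<^esub>"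
    by (auto simp: Aut_def Ad_def intro!: restrict_ext blinfun_eqI)
  have "subgroup ?N (Aut ?Roe)"
  proof (rule subgroupI)
    show "?N \<subseteq> carrier (Aut ?Roe)" using N_carrier by (auto simp: N_eq)
    have "unitary (id_blinfun :: ('x, 'h) ell2 \<Rightarrow>\<^sub>L ('x, 'h) ell2)"
      unfolding unitary_def by (intro conjI blinfun_eqI) simp_all
    then show "?N \<noteq> {}"
      unfolding N_eq using id_BD by blast
    fix h assume "h \<in> ?N"
    then obtain u where u: "u \<in> BD" "unitary u" "h = restrict (Ad u) Roe"
      by (auto simp: N_eq)
    have lin: "u \<in> clinear_operators" by (rule BD_clinear[OF u(1)])
    have adj: "adj u \<in> BD" "unitary (adj u)"
      using u lin by (simp_all add: BD_adj unitary_adj)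
    have "restrict (Ad (adj u)) Roe \<otimes>\<^bsub>Aut ?Roe\<^esub> h = \<one>\<^bsub>Aut ?Roe\<^esub>"
      using N_mult[OF clinear_operators_adj[OF lin] u(1)] one by (simp add: u(3) unitaryD(1)[OF u(2)])
    then have "inv\<^bsub>Aut ?Roe\<^esub> h = restrict (Ad (adj u)) Roe"
      using inv_equality N_carrier u adj by blast
    then show "inv\<^bsub>Aut ?Roe\<^esub> h \<in> ?N" using adj by (auto simp: N_eq)
    fix k assume "k \<in> ?N"
    then obtain v where v: "v \<in> BD" "unitary v" "k = restrict (Ad v) Roe"
      by (auto simp: N_eq)
    have "h \<otimes>\<^bsub>Aut ?Roe\<^esub> k = restrict (Ad (u o\<^sub>L v)) Roe"
      using N_mult[OF lin v(1)] by (simp add: u(3) v(3))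
    then show "h \<otimes>\<^bsub>Aut ?Roe\<^esub> k \<in> ?N"
      using BD_compose[OF u(1) v(1)] unitary_compose[OF lin BD_clinear[OF v(1)] u(2) v(2)]
      by (auto simp: N_eq)
  qed
  moreover have "\<Phi> \<otimes>\<^bsub>Aut ?Roe\<^esub> h \<otimes>\<^bsub>Aut ?Roe\<^esub> inv\<^bsub>Aut ?Roe\<^esub> \<Phi> \<in> ?N"
    if \<Phi>: "\<Phi> \<in> carrier (Aut ?Roe)" and "h \<in> ?N" for \<Phi> h
  proof -
    obtain v where v: "v \<in> BD" "unitary v" "h = restrict (Ad v) Roe"
      using \<open>h \<in> ?N\<close> by (auto simp: N_eq)
    have "\<Phi> \<in> star_automorphisms Roe" using \<Phi> by (simp add: Aut_def)
    from spatial[OF this] obtain u where u: "u \<in> clinear_operators" "unitary u"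
        "\<And>a. a \<in> Roe \<Longrightarrow> \<Phi> a = Ad u a"
        "\<And>a. a \<in> ?Roe \<Longrightarrow> Ad u a \<in> Roe" "\<And>m. m \<in> BD \<Longrightarrow> Ad u m \<in> BD"
      by blast
    define w where "w = Ad u v"
    have w: "w \<in> BD" "w \<in> clinear_operators" using u(5)[OF v(1)] by (simp_all add: w_def BD_clinear)
    have adj_w: "adj w = Ad u (adj v)"
      using BD_clinear[OF v(1)] u(1)
      by (simp add: w_def Ad_def adj_compose adj_adj clinear_operators_compose clinear_operators_adj
          blinfun_compose_assoc)
    have "unitary w"
      unfolding unitary_def adj_w
      by (intro conjI blinfun_eqI) (simp_all add: w_def Ad_def unitaryD[OF u(2)] unitaryD[OF v(2)])
    \<comment> \<open>Checked in this form, without the inverse, conjugation in the group is an identity of operators.\<close>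
    have "restrict (Ad w) Roe \<otimes>\<^bsub>Aut ?Roe\<^esub> \<Phi> = \<Phi> \<otimes>\<^bsub>Aut ?Roe\<^esub> h"
    proof -
      have "Ad w (Ad u a) = Ad u (Ad v a)" for a
        unfolding Ad_def[of w] adj_w unfolding w_def Ad_compose[OF u(2), symmetric] Ad_def[of v] ..
      then show ?thesis
        using u(3,4) Ad_Roe[OF v(1)] by (auto simp: Aut_def compose_def v(3) intro!: restrict_ext)
    qed
    then have "\<Phi> \<otimes>\<^bsub>Aut ?Roe\<^esub> h \<otimes>\<^bsub>Aut ?Roe\<^esub> inv\<^bsub>Aut ?Roe\<^esub> \<Phi> = restrict (Ad w) Roe"
      using inv_solve_right N_carrier w(1) \<open>unitary w\<close> \<Phi> v m_closed by metis
    then show ?thesis using w(1) \<open>unitary w\<close> by (auto simp: N_eq)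
  qed
  ultimately have "?N \<lhd> Aut ?Roe" by (simp add: normal_inv_iff)
  with extension show ?thesis by blast
qed

end
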